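(* Let $Z_1,\dots,Z_{T+1}$ be a stochastic process with values in $\mathcal Z=\mathcal X\times\mathcal Y$, with $\mathbf Z_1^T$ distributed according to $\mathbf p$, let $\mathcal F$ be a family of loss functions on $\mathcal Z$ bounded by $M$, and let $\mathbf q=(q_1,\dots,q_T)\in\mathbb R^T$, $\mathbf q\ne0$, be a fixed weight vector. For any $\delta>0$, with probability at least $1-\delta$, for all $f\in\mathcal F$ and all $\alpha>0$, $$\mathbb E[f(Z_{T+1})\mid\mathbf Z_1^T]\le\sum_{t=1}^Tq_tf(Z_t)+\mathrm{disc}(\mathbf q)+2\alpha+M\|\mathbf q\|_2\sqrt{2\log\frac{\mathbb E_{\mathbf v\sim T(\mathbf p)}[\mathcal N_1(\alpha,\mathcal F,\mathbf v)]}{\delta}},$$ where $\mathrm{disc}(\mathbf q)=\sup_{f\in\mathcal F}\big(\mathbb E[f(Z_{T+1})\mid\mathbf Z_1^T]-\sum_{t=1}^T q_t\,\mathbb E[f(Z_t)\mid\mathbf Z_1^{t-1}]\big)$.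
   Context: Setting: $H$ is a set of hypotheses $h:\mathcal X\to\mathcal Y$, $L:\mathcal Y\times\mathcal Y\to[0,\infty)$ is a loss function, and $\mathcal F=\{(x,y)\mapsto L(h(x),y): h\in H\}$. It is assumed that $|f|\le M$ for all $f\in\mathcal F$ (so $0\le f\le M$). $\mathbf Z_a^b$ denotes $(Z_a,\dots,Z_b)$. The weights $q_t$ are arbitrary real numbers. Trees: an $A$-valued complete binary tree of depth $T$ is a sequence $\mathbf z=(z_1,\dots,z_T)$ of maps $z_t:\{\pm1\}^{t-1}\to A$; for $\sigma\in\{\pm1\}^T$ write $z_t(\sigma)=z_t(\sigma_1,\dots,\sigma_{t-1})$. Sequential covers: a set $V$ of $\mathbb R$-valued trees of depth $T$ is a sequential $\alpha$-cover (with respect to the $\mathbf q$-weighted $\ell_1$ norm) of a class $\mathcal G$ of real functions on $\mathcal Z$ on a $\mathcal Z$-valued tree $\mathbf z$ if for all $g\in\mathcal G$ and $\sigma\in\{\pm1\}^T$ there is $\mathbf v\in V$ with $\sum_{t=1}^T|v_t(\sigma)-g(z_t(\sigma))|\le\|\mathbf q\|_\infty^{-1}\alpha$. $\mathcal N_1(\alpha,\mathcal G,\mathbf z)$ is the minimal size of such a cover. Random tree: let $\mathbf p_t(\cdot\mid z_1,\dots,z_{t-1})$ be the conditional distribution of $Z_t$ given the past. A random $\mathcal Z\times\mathcal Z$-valued tree is drawn recursively: at the root draw independent $Z_1,Z_1'\sim\mathbf p_1$; at the node reached by $(\sigma_1,\dots,\sigma_{t-1})$ draw fresh independent $Z_t,Z_t'\sim\mathbf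 p_t(\cdot\mid S_1(\sigma_1),\dots,S_{t-1}(\sigma_{t-1}))$, where $S_i(1)=Z_i$ and $S_i(-1)=Z_i'$ are the values drawn at the ancestors along the path. $T(\mathbf p)$ is the distribution of the $\mathcal Z$-valued tree formed by the unprimed variables $Z_t$.
   Formalization: The family F is additionally assumed measurable: its members are measurable and so are suprema over F of finite weighted sums of f(z_i); without such a condition the bound can fail for uncountable families with non-measurable suprema. *)

theory Defs
  imports "HOL-Probability.Probability"
begin

definition loss_class :: "('y \<Rightarrow> 'y \<Rightarrow> real) \<Rightarrow> ('x \<Rightarrow> 'y) set \<Rightarrow> ('x \<times> 'y \<Rightarrow> real) set" where
  "loss_class L H = (\<lambda>h (x, y). L (h x) y) ` H"

text \<open>
  Measurable classes in the usual empirical-process sense. The suprema below range over a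
  possibly uncountable class, so their measurability does not follow from that of the members.
\<close>

definition measurable_class :: "'z measure \<Rightarrow> ('z \<Rightarrow> real) set \<Rightarrow> bool" where
  "measurable_class S F \<longleftrightarrow>
     F \<subseteq> borel_measurable S \<and>
     (\<forall>n (c :: nat \<Rightarrow> real).
        (\<lambda>z. SUP f\<in>F. \<Sum>i=1..n. c i * f (z i)) \<in> borel_measurable (PiM {1..n} (\<lambda>_. S)))"

definition past :: "(nat \<Rightarrow> 'w \<Rightarrow> 'z) \<Rightarrow> nat \<Rightarrow> 'w \<Rightarrow> nat \<Rightarrow> 'z" where
  "past Z t \<omega> = (\<lambda>i\<in>{1..<t}. Z i \<omega>)"

text \<open>
  \<open>p t\<close> is a regular conditional distribution of \<open>Z t\<close> given \<open>Z 1, \<dots>, Z (t - 1)\<close>,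
  for \<open>1 \<le> t \<le> n\<close>.
\<close>

definition conditional_laws ::
  "'w measure \<Rightarrow> 'z measure \<Rightarrow> (nat \<Rightarrow> 'w \<Rightarrow> 'z) \<Rightarrow> nat
     \<Rightarrow> (nat \<Rightarrow> (nat \<Rightarrow> 'z) \<Rightarrow> 'z measure) \<Rightarrow> bool" where
  "conditional_laws W S Z n p \<longleftrightarrow>
     (\<forall>t\<in>{1..n}.
        p t \<in> PiM {1..<t} (\<lambda>_. S) \<rightarrow>\<^sub>M prob_algebra S \<and>
        (\<forall>B\<in>sets S. AE \<omega> in W.
           real_cond_exp W (vimage_algebra (space W) (past Z t) (PiM {1..<t} (\<lambda>_. S)))
             (\<lambda>\<omega>. indicator B (Z t \<omega>)) \<omega>
           = measure (p t (past Z t \<omega>)) B))"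

text \<open>
  Conditional expectations \<open>E[f(Z\<^sub>t) | Z\<^sub>1, \<dots>, Z\<^sub>t\<^sub>-\<^sub>1]\<close> are taken with respect to the regular
  conditional distribution, which fixes one version simultaneously for all \<open>f\<close>;
  lemma \<open>cond_mean_eq_real_cond_exp\<close> below relates this to \<open>real_cond_exp\<close>.
\<close>

definition cond_mean ::
  "(nat \<Rightarrow> (nat \<Rightarrow> 'z) \<Rightarrow> 'z measure) \<Rightarrow> (nat \<Rightarrow> 'w \<Rightarrow> 'z) \<Rightarrow> nat \<Rightarrow> ('z \<Rightarrow> real) \<Rightarrow> 'w \<Rightarrow> real"
where
  "cond_mean p Z t f \<omega> = (\<integral>z. f z \<partial>p t (past Z t \<omega>))"

definition disc ::
  "(nat \<Rightarrow> (nat \<Rightarrow> 'z) \<Rightarrow> 'z measure) \<Rightarrow> (nat \<Rightarrow> 'w \<Rightarrow> 'z) \<Rightarrow> nat \<Rightarrow> ('z \<Rightarrow> real) set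
     \<Rightarrow> (nat \<Rightarrow> real) \<Rightarrow> 'w \<Rightarrow> real"
where
  "disc p Z T F q \<omega> =
     (SUP f\<in>F. cond_mean p Z (Suc T) f \<omega> - (\<Sum>t=1..T. q t * cond_mean p Z t f \<omega>))"

text \<open>
  Complete binary trees of depth \<open>T\<close>: the node reached by \<open>(\<sigma>\<^sub>1, \<dots>, \<sigma>\<^sub>t\<^sub>-\<^sub>1)\<close> is the list of these
  signs, with \<open>True\<close> for \<open>+1\<close> and \<open>False\<close> for \<open>-1\<close>, so \<open>z\<^sub>t(\<sigma>)\<close> is \<open>z (take (t - 1) \<sigma>)\<close>.
\<close>

definition nodes :: "nat \<Rightarrow> bool list set" where
  "nodes T = {s. length s < T}"

definition trees :: "nat \<Rightarrow> 'a set \<Rightarrow> (bool list \<Rightarrow> 'a) set" where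
  "trees T A = nodes T \<rightarrow>\<^sub>E A"

definition sup_norm :: "(nat \<Rightarrow> real) \<Rightarrow> nat \<Rightarrow> real" where
  "sup_norm q T = Max ((\<lambda>t. \<bar>q t\<bar>) ` {1..T})"

definition seq_cover ::
  "nat \<Rightarrow> (nat \<Rightarrow> real) \<Rightarrow> real \<Rightarrow> ('z \<Rightarrow> real) set \<Rightarrow> (bool list \<Rightarrow> 'z)
     \<Rightarrow> (bool list \<Rightarrow> real) set \<Rightarrow> bool"
where
  "seq_cover T q \<alpha> G z V \<longleftrightarrow>
     V \<subseteq> trees T UNIV \<and>
     (\<forall>g\<in>G. \<forall>\<sigma>. length \<sigma> = T \<longrightarrow>
        (\<exists>v\<in>V. (\<Sum>t=1..T. \<bar>v (take (t - 1) \<sigma>) - g (z (take (t - 1) \<sigma>))\<bar>)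
                 \<le> inverse (sup_norm q T) * \<alpha>))"

text \<open>The value is \<open>\<infinity>\<close> if there is no finite cover.\<close>

definition seq_cover_num ::
  "nat \<Rightarrow> (nat \<Rightarrow> real) \<Rightarrow> real \<Rightarrow> ('z \<Rightarrow> real) set \<Rightarrow> (bool list \<Rightarrow> 'z) \<Rightarrow> ennreal"
where
  "seq_cover_num T q \<alpha> G z = (INF V\<in>{V. finite V \<and> seq_cover T q \<alpha> G z V}. of_nat (card V))"

text \<open>The history \<open>S\<^sub>1(s\<^sub>1), \<dots>, S\<^sub>n(s\<^sub>n)\<close> leading to node \<open>s\<close> of length \<open>n\<close> in a pair tree \<open>w\<close>\<close>

definition history :: "(bool list \<Rightarrow> 'z \<times> 'z) \<Rightarrow> bool list \<Rightarrow> nat \<Rightarrow> 'z" where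
  "history w s =
     (\<lambda>i\<in>{1..length s}.
        (if s ! (i - 1) then fst (w (take (i - 1) s)) else snd (w (take (i - 1) s))))"

text \<open>
  Law of the random pair tree, drawn level by level: given the first \<open>n\<close> levels, the pairs at the
  nodes of the next level are independent, and each consists of two independent draws.
\<close>

primrec pair_tree_law ::
  "(nat \<Rightarrow> (nat \<Rightarrow> 'z) \<Rightarrow> 'z measure) \<Rightarrow> 'z measure \<Rightarrow> nat \<Rightarrow> (bool list \<Rightarrow> 'z \<times> 'z) measure"
where
  "pair_tree_law p S 0 = return (PiM (nodes 0) (\<lambda>_. S \<Otimes>\<^sub>M S)) (\<lambda>_. undefined)"
| "pair_tree_law p S (Suc n) =
     pair_tree_law p S n \<bind> (\<lambda>w.
       distr
         (PiM {s. length s = n}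
            (\<lambda>s. p (Suc n) (history w s) \<Otimes>\<^sub>M p (Suc n) (history w s)))
         (PiM (nodes (Suc n)) (\<lambda>_. S \<Otimes>\<^sub>M S))
         (\<lambda>u. merge (nodes n) {s. length s = n} (w, u)))"

definition tree_law ::
  "(nat \<Rightarrow> (nat \<Rightarrow> 'z) \<Rightarrow> 'z measure) \<Rightarrow> 'z measure \<Rightarrow> nat \<Rightarrow> (bool list \<Rightarrow> 'z) measure" where
  "tree_law p S T =
     distr (pair_tree_law p S T) (PiM (nodes T) (\<lambda>_. S)) (\<lambda>w. \<lambda>s\<in>nodes T. fst (w s))"

text \<open>
  Upper expectation: the expectation of the integrand whenever that is measurable (lemma
  \<open>upper_expectation_eq_nn_integral\<close>). For other integrands \<open>nn_integral\<close> is a lower integral.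
\<close>

definition upper_expectation :: "'a measure \<Rightarrow> ('a \<Rightarrow> ennreal) \<Rightarrow> ennreal" where
  "upper_expectation M u =
     (INF g\<in>{g \<in> borel_measurable M. \<forall>x\<in>space M. u x \<le> g x}. \<integral>\<^sup>+ x. g x \<partial>M)"

lemma upper_expectation_eq_nn_integral:
  assumes "u \<in> borel_measurable M"
  shows "upper_expectation M u = (\<integral>\<^sup>+ x. u x \<partial>M)"
  unfolding upper_expectation_def
proof (rule antisym)
  show "(INF g\<in>{g \<in> borel_measurable M. \<forall>x\<in>space M. u x \<le> g x}. \<integral>\<^sup>+ x. g x \<partial>M) \<le> (\<integral>\<^sup>+ x. u x \<partial>M)"
    using assms by (intro INF_lower) auto
  show "(\<integral>\<^sup>+ x. u x \<partial>M) \<le> (INF g\<in>{g \<in> borel_measurable M. \<forall>x\<in>space M. u x \<le> g x}. \<integral>\<^sup>+ x. g x \<partial>M)"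
    by (intro INF_greatest nn_integral_mono) auto
qed

lemma finite_nodes: "finite (nodes n)"
proof -
  have "finite {s :: bool list. set s \<subseteq> UNIV \<and> length s \<le> n}"
    by (rule finite_lists_length_le) simp
  then show ?thesis by (rule rev_finite_subset) (auto simp: nodes_def)
qed

lemma finite_level: "finite {s :: bool list. length s = n}"
  using finite_lists_length_eq[of "UNIV :: bool set" n] by simp

lemma measurable_history:
  assumes "length s = n"
  shows "(\<lambda>w. history w s) \<in> PiM (nodes n) (\<lambda>_. S \<Otimes>\<^sub>M S) \<rightarrow>\<^sub>M PiM {1..<Suc n} (\<lambda>_. S)"
proof -
  have eq: "{1..<Suc n} = {1..length s}" using assms by auto
  have comp: "(\<lambda>w. w (take (i - 1) s)) \<in> PiM (nodes n) (\<lambda>_. S \<Otimes>\<^sub>M S) \<rightarrow>\<^sub>M S \<Otimes>\<^sub>M S"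
    if "i \<in> {1..length s}" for i
    using that assms by (intro measurable_component_singleton) (auto simp: nodes_def)
  show ?thesis
    unfolding history_def eq
  proof (rule measurable_restrict)
    fix i assume "i \<in> {1..length s}"
    note c = comp[OF this]
    show "(\<lambda>w. if s ! (i - 1) then fst (w (take (i - 1) s)) else snd (w (take (i - 1) s)))
            \<in> PiM (nodes n) (\<lambda>_. S \<Otimes>\<^sub>M S) \<rightarrow>\<^sub>M S"
      using measurable_compose[OF c measurable_fst] measurable_compose[OF c measurable_snd]
      by (cases "s ! (i - 1)") simp_all
  qed
qed

lemma measurable_PiM_kernel:
  assumes "finite I" and K: "\<And>i. i \<in> I \<Longrightarrow> K i \<in> A \<rightarrow>\<^sub>M prob_algebra N"
  shows "(\<lambda>w. PiM I (\<lambda>i. K i w)) \<in> A \<rightarrow>\<^sub>M prob_algebra (PiM I (\<lambda>_. N))"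
proof -
  have prob: "prob_space (K i w)" and sets: "sets (K i w) = sets N"
    if "i \<in> I" "w \<in> space A" for i w
    using measurable_space[OF K[OF that(1)] that(2)] by (auto simp: space_prob_algebra)
  have emeas: "emeasure (PiM I (\<lambda>i. K i w)) (Pi\<^sub>E I X) = (\<Prod>i\<in>I. emeasure (K i w) (X i))"
    if w: "w \<in> space A" and X: "X \<in> (\<Pi> i\<in>I. sets N)" for w X
  proof -
    define K' where "K' i = (if i \<in> I then K i w else return (count_space UNIV) undefined)" for i
    have eq: "PiM I (\<lambda>i. K i w) = PiM I K'"
      by (rule PiM_cong) (auto simp: K'_def)
    have p: "prob_space (K' i)" for i
      using prob w by (auto simp: K'_def prob_space_return)
    then interpret finite_product_sigma_finite K' I
      using assms(1)
      by (intro finite_product_sigma_finite.intro product_sigma_finite.intro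
            finite_product_sigma_finite_axioms.intro prob_space_imp_sigma_finite) auto
    have "emeasure (PiM I K') (Pi\<^sub>E I X) = (\<Prod>i\<in>I. emeasure (K' i) (X i))"
      using X w by (intro measure_times) (auto simp: K'_def sets Pi_iff)
    also have "\<dots> = (\<Prod>i\<in>I. emeasure (K i w) (X i))"
      by (intro prod.cong) (auto simp: K'_def)
    finally show ?thesis by (simp add: eq)
  qed
  show ?thesis
  proof (rule measurable_prob_algebra_generated)
    show "sets (PiM I (\<lambda>_. N)) = sigma_sets (\<Pi>\<^sub>E i\<in>I. space N) (prod_algebra I (\<lambda>_. N))"
      by (rule sets_PiM)
    show "Int_stable (prod_algebra I (\<lambda>_. N))" by (rule Int_stable_prod_algebra)
    show "prod_algebra I (\<lambda>_. N) \<subseteq> Pow (\<Pi>\<^sub>E i\<in>I. space N)" by (rule prod_algebra_sets_into_space)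
    show "prob_space (PiM I (\<lambda>i. K i w))" if "w \<in> space A" for w
      using prob that by (intro prob_space_PiM)
    show "sets (PiM I (\<lambda>i. K i w)) = sets (PiM I (\<lambda>_. N))" if "w \<in> space A" for w
      using sets that by (intro sets_PiM_cong) auto
    fix E assume "E \<in> prod_algebra I (\<lambda>_. N)"
    then obtain X where E: "E = Pi\<^sub>E I X" and X: "X \<in> (\<Pi> i\<in>I. sets N)"
      using assms(1) by (auto simp: prod_algebra_eq_finite)
    have "(\<lambda>w. \<Prod>i\<in>I. emeasure (K i w) (X i)) \<in> borel_measurable A"
      using X K
      by (intro borel_measurable_prod_ennreal)
        (auto simp: Pi_iff intro: measurable_prob_algebraD
          intro!: measurable_compose[OF _ measurable_emeasure_subprob_algebra])
    then show "(\<lambda>w. emeasure (PiM I (\<lambda>i. K i w)) E) \<in> borel_measurable A"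
      unfolding E by (subst measurable_cong[OF emeas[OF _ X]]) auto
  qed
qed

lemma pair_tree_law_in_prob_algebra:
  assumes "\<And>t. t \<in> {1..n} \<Longrightarrow> p t \<in> PiM {1..<t} (\<lambda>_. S) \<rightarrow>\<^sub>M prob_algebra S"
  shows "pair_tree_law p S n \<in> space (prob_algebra (PiM (nodes n) (\<lambda>_. S \<Otimes>\<^sub>M S)))"
  using assms
proof (induction n)
  case 0
  show ?case
    by (auto simp: space_prob_algebra nodes_def space_PiM intro!: prob_space_return)
next
  case (Suc n)
  let ?P = "\<lambda>J :: bool list set. PiM J (\<lambda>_. S \<Otimes>\<^sub>M S)"
  let ?l = "{s :: bool list. length s = n}"
  have IH: "pair_tree_law p S n \<in> space (prob_algebra (?P (nodes n)))"
    using Suc by auto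
  have k: "(\<lambda>w. p (Suc n) (history w s) \<Otimes>\<^sub>M p (Suc n) (history w s))
             \<in> ?P (nodes n) \<rightarrow>\<^sub>M prob_algebra (S \<Otimes>\<^sub>M S)" if "s \<in> ?l" for s
  proof -
    have "(\<lambda>w. p (Suc n) (history w s)) \<in> ?P (nodes n) \<rightarrow>\<^sub>M prob_algebra S"
      using measurable_compose[OF measurable_history Suc.prems[of "Suc n"]] that by auto
    then show ?thesis by (intro measurable_pair_prob)
  qed
  have U: "nodes n \<union> ?l = nodes (Suc n)" by (auto simp: nodes_def)
  have m: "(\<lambda>(w, u). merge (nodes n) ?l (w, u)) \<in> ?P (nodes n) \<Otimes>\<^sub>M ?P ?l \<rightarrow>\<^sub>M ?P (nodes (Suc n))"
    using measurable_merge[of "nodes n" ?l "\<lambda>_. S \<Otimes>\<^sub>M S"] by (simp add: U)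
  have kern: "(\<lambda>w. distr (PiM ?l (\<lambda>s. p (Suc n) (history w s) \<Otimes>\<^sub>M p (Suc n) (history w s)))
           (?P (nodes (Suc n))) (\<lambda>u. merge (nodes n) ?l (w, u)))
           \<in> ?P (nodes n) \<rightarrow>\<^sub>M prob_algebra (?P (nodes (Suc n)))"
    by (rule measurable_distr_prob_space2[OF measurable_PiM_kernel[OF finite_level k] m])
  show ?case
    using prob_space_bind'[OF IH kern] sets_bind'[OF IH kern] by (simp add: space_prob_algebra)
qed

lemma tree_law_in_prob_algebra:
  assumes "\<And>t. t \<in> {1..n} \<Longrightarrow> p t \<in> PiM {1..<t} (\<lambda>_. S) \<rightarrow>\<^sub>M prob_algebra S"
  shows "tree_law p S n \<in> space (prob_algebra (PiM (nodes n) (\<lambda>_. S)))"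
proof -
  have m: "(\<lambda>w. \<lambda>s\<in>nodes n. fst (w s)) \<in> PiM (nodes n) (\<lambda>_. S \<Otimes>\<^sub>M S) \<rightarrow>\<^sub>M PiM (nodes n) (\<lambda>_. S)"
    by (intro measurable_restrict) simp
  show ?thesis
    using measurable_space[OF measurable_distr_prob_space[OF m] pair_tree_law_in_prob_algebra[OF assms]]
    by (simp add: tree_law_def)
qed

lemma cond_mean_eq_real_cond_exp:
  assumes W: "prob_space W"
    and Z: "\<And>i. i \<in> {1..n} \<Longrightarrow> Z i \<in> W \<rightarrow>\<^sub>M S"
    and p: "conditional_laws W S Z n p" and t: "t \<in> {1..n}"
    and f [measurable]: "f \<in> borel_measurable S"
    and bounds: "\<And>z. z \<in> space S \<Longrightarrow> 0 \<le> f z \<and> f z \<le> C"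
  shows "AE \<omega> in W.
    real_cond_exp W (vimage_algebra (space W) (past Z t) (PiM {1..<t} (\<lambda>_. S)))
      (\<lambda>\<omega>. f (Z t \<omega>)) \<omega> = cond_mean p Z t f \<omega>"
proof -
  interpret prob_space W by (rule W)
  let ?P = "PiM {1..<t} (\<lambda>_. S)"
  let ?F = "vimage_algebra (space W) (past Z t) ?P"
  let ?k = "\<lambda>\<omega>. p t (past Z t \<omega>)"
  have past: "past Z t \<in> W \<rightarrow>\<^sub>M ?P"
    unfolding past_def using t by (intro measurable_restrict Z) auto
  have pastF: "past Z t \<in> ?F \<rightarrow>\<^sub>M ?P"
    using past by (intro measurable_vimage_algebra1) (auto dest: measurable_space)
  have sub: "subalgebra W ?F"
  proof -
    have "past Z t \<in> space W \<rightarrow> space ?P" using measurable_space[OF past] by blast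
    then show ?thesis
      unfolding subalgebra_def sets_vimage_algebra2[OF \<open>past Z t \<in> space W \<rightarrow> space ?P\<close>]
      using measurable_sets[OF past] by auto
  qed
  interpret finite_measure_subalgebra W ?F
    by unfold_locales (rule sub)
  have [measurable]: "Z t \<in> W \<rightarrow>\<^sub>M S" using Z t by simp
  have pt: "p t \<in> ?P \<rightarrow>\<^sub>M prob_algebra S"
    and ce: "B \<in> sets S \<Longrightarrow> AE \<omega> in W. real_cond_exp W ?F (\<lambda>\<omega>. indicator B (Z t \<omega>)) \<omega> = measure (?k \<omega>) B" for B
    using p t by (auto simp: conditional_laws_def)
  have k: "?k \<in> W \<rightarrow>\<^sub>M prob_algebra S" using past pt by (rule measurable_compose)
  have k' [measurable]: "?k \<in> W \<rightarrow>\<^sub>M subprob_algebra S" using k by (rule measurable_prob_algebraD)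
  have kF: "?k \<in> ?F \<rightarrow>\<^sub>M subprob_algebra S"
    using measurable_compose[OF pastF pt] by (rule measurable_prob_algebraD)
  have kp: "prob_space (?k \<omega>)" and ks: "sets (?k \<omega>) = sets S" if "\<omega> \<in> space W" for \<omega>
    using measurable_space[OF k that] by (auto simp: space_prob_algebra)
  note sp = sets_eq_imp_space_eq[OF ks]
  have cmF: "cond_mean p Z t f \<in> borel_measurable ?F"
    unfolding cond_mean_def by (rule measurable_compose[OF kF integral_measurable_subprob_algebra[OF f]])
  have cm [measurable]: "cond_mean p Z t f \<in> borel_measurable W"
    by (rule measurable_from_subalg[OF sub cmF])
  have kint: "integrable (?k \<omega>) f" if "\<omega> \<in> space W" for \<omega>
  proof -
    interpret K: prob_space "?k \<omega>" using kp that .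
    show ?thesis
      using bounds sp[OF that] f ks[OF that]
      by (intro K.integrable_const_bound[where B = C] AE_I2) (auto cong: measurable_cong_sets)
  qed
  have cm_nn: "(\<integral>\<^sup>+ z. f z \<partial>?k \<omega>) = ennreal (cond_mean p Z t f \<omega>)"
    and cm0: "0 \<le> cond_mean p Z t f \<omega>" and cmC: "cond_mean p Z t f \<omega> \<le> C"
    if w: "\<omega> \<in> space W" for \<omega>
  proof -
    interpret K: prob_space "?k \<omega>" using kp that .
    show "(\<integral>\<^sup>+ z. f z \<partial>?k \<omega>) = ennreal (cond_mean p Z t f \<omega>)"
      unfolding cond_mean_def using kint[OF w] bounds sp[OF w]
      by (intro nn_integral_eq_integral) (auto intro!: AE_I2)
    show "0 \<le> cond_mean p Z t f \<omega>"
      unfolding cond_mean_def using bounds sp[OF w] by (intro integral_nonneg_AE) (auto intro!: AE_I2)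
    show "cond_mean p Z t f \<omega> \<le> C"
      unfolding cond_mean_def using kint[OF w] bounds sp[OF w]
      by (intro K.integral_le_const) (auto intro!: AE_I2)
  qed
  have intf: "integrable W (\<lambda>\<omega>. f (Z t \<omega>))"
    using bounds measurable_space[OF \<open>Z t \<in> W \<rightarrow>\<^sub>M S\<close>]
    by (intro integrable_const_bound[where B = C] AE_I2) auto
  have intc: "integrable W (cond_mean p Z t f)"
    using cm0 cmC by (intro integrable_const_bound[where B = C] AE_I2) auto
  show ?thesis
  proof (rule real_cond_exp_charact[OF _ intf intc cmF])
    fix A assume A: "A \<in> sets ?F"
    have AW [measurable]: "A \<in> sets W" using A sub by (auto simp: subalgebra_def)
    define D where "D = density W (indicator A)"
    have sD [measurable_cong]: "sets D = sets W" and spD: "space D = space W" by (auto simp: D_def)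
    have ne: "space D \<noteq> {}" using not_empty spD by simp
    have kD: "?k \<in> D \<rightarrow>\<^sub>M subprob_algebra S" by measurable
    have eq: "distr D S (Z t) = D \<bind> ?k"
    proof (rule measure_eqI)
      show "sets (distr D S (Z t)) = sets (D \<bind> ?k)"
        using ne ks spD by (subst sets_bind[where N = S]) auto
      fix B assume "B \<in> sets (distr D S (Z t))"
      then have B [measurable]: "B \<in> sets S" by simp
      have i1: "integrable W (\<lambda>\<omega>. indicator B (Z t \<omega>) :: real)"
        by (intro integrable_const_bound[where B = 1] AE_I2) auto
      have m2: "(\<lambda>\<omega>. measure (?k \<omega>) B) \<in> borel_measurable W" by measurable
      have i2: "integrable W (\<lambda>\<omega>. measure (?k \<omega>) B)"
        using kp m2 by (intro integrable_const_bound[where B = 1] AE_I2) (auto simp: prob_space.prob_le_1)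
      have "emeasure (distr D S (Z t)) B = (\<integral>\<^sup>+ \<omega>. indicator B (Z t \<omega>) \<partial>D)"
        by (subst nn_integral_distr[symmetric, of _ _ S]) auto
      also have "\<dots> = (\<integral>\<^sup>+ \<omega>. ennreal (indicator A \<omega> * indicator B (Z t \<omega>)) \<partial>W)"
        unfolding D_def by (subst nn_integral_density) (auto intro!: nn_integral_cong split: split_indicator)
      also have "\<dots> = ennreal (\<integral>\<omega>\<in>A. indicator B (Z t \<omega>) \<partial>W)"
        unfolding set_lebesgue_integral_def using integrable_mult_indicator[OF AW i1]
        by (subst nn_integral_eq_integral) auto
      also have "(\<integral>\<omega>\<in>A. indicator B (Z t \<omega>) \<partial>W :: real) = (\<integral>\<omega>\<in>A. measure (?k \<omega>) B \<partial>W)"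
      proof (rule trans[OF real_cond_exp_intA[OF i1 A]])
        show "(\<integral>\<omega>\<in>A. real_cond_exp W ?F (\<lambda>\<omega>. indicator B (Z t \<omega>)) \<omega> \<partial>W)
                = (\<integral>\<omega>\<in>A. measure (?k \<omega>) B \<partial>W)"
          unfolding set_lebesgue_integral_def
          using ce[OF B] m2 by (intro integral_cong_AE) (auto elim!: eventually_mono)
      qed
      also have "ennreal \<dots> = (\<integral>\<^sup>+ \<omega>. ennreal (indicator A \<omega> * measure (?k \<omega>) B) \<partial>W)"
        unfolding set_lebesgue_integral_def using integrable_mult_indicator[OF AW i2]
        by (subst nn_integral_eq_integral) auto
      also have "\<dots> = (\<integral>\<^sup>+ \<omega>. emeasure (?k \<omega>) B \<partial>D)"
        unfolding D_def using kp
        by (subst nn_integral_density)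
          (auto intro!: nn_integral_cong split: split_indicator
            simp: finite_measure.emeasure_eq_measure prob_space.finite_measure)
      also have "\<dots> = emeasure (D \<bind> ?k) B"
        by (rule emeasure_bind[symmetric, OF ne kD B])
      finally show "emeasure (distr D S (Z t)) B = emeasure (D \<bind> ?k) B" .
    qed
    have "(\<integral>\<^sup>+ \<omega>. ennreal (indicator A \<omega> * f (Z t \<omega>)) \<partial>W) = (\<integral>\<^sup>+ \<omega>. f (Z t \<omega>) \<partial>D)"
      unfolding D_def by (subst nn_integral_density) (auto intro!: nn_integral_cong split: split_indicator)
    also have "\<dots> = (\<integral>\<^sup>+ z. f z \<partial>(D \<bind> ?k))"
      unfolding eq[symmetric] by (subst nn_integral_distr) auto
    also have "\<dots> = (\<integral>\<^sup>+ \<omega>. \<integral>\<^sup>+ z. f z \<partial>?k \<omega> \<partial>D)"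
      by (rule nn_integral_bind[OF _ kD]) simp
    also have "\<dots> = (\<integral>\<^sup>+ \<omega>. ennreal (cond_mean p Z t f \<omega>) \<partial>D)"
      using cm_nn spD by (intro nn_integral_cong) auto
    also have "\<dots> = (\<integral>\<^sup>+ \<omega>. ennreal (indicator A \<omega> * cond_mean p Z t f \<omega>) \<partial>W)"
      unfolding D_def by (subst nn_integral_density) (auto intro!: nn_integral_cong split: split_indicator)
    finally show "(\<integral>\<omega>\<in>A. f (Z t \<omega>) \<partial>W) = (\<integral>\<omega>\<in>A. cond_mean p Z t f \<omega> \<partial>W)"
      unfolding set_lebesgue_integral_def using bounds cm0 measurable_space[OF \<open>Z t \<in> W \<rightarrow>\<^sub>M S\<close>]
      by (subst (1 2) integral_eq_nn_integral) (auto intro!: AE_I2)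
  qed
qed

end

theory Submission
  imports Defs
begin

text \<open>
  Write \<open>gap f = (\<Sum>t. q t (E[f(Z t) | past] - f(Z t)))\<close>; by the definition of the discrepancy it suffices
  to bound \<open>gap f\<close> uniformly in \<open>f\<close>. Let \<open>Z' t\<close> be drawn from the conditional law of \<open>Z t\<close>,
  independently given the whole process. By Jensen, \<open>exp (r gap f)\<close> is at most the conditional
  expectation of \<open>exp (r (\<Sum>t. q t (f(Z' t) - f(Z t))))\<close>. For a sign sequence \<open>\<sigma>\<close>, exchange \<open>Z t\<close> and \<open>Z' t\<close>
  in the notation wherever the sign is negative and split the exponent by
  \<open>exp (x + y) \<le> (exp (2 x) + exp (2 y)) / 2\<close>; the two halves belong to \<open>\<sigma>\<close> and \<open>-\<sigma>\<close>, so averaging over all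
  signs makes them equal. Along every fixed branch \<open>\<sigma>\<close> of the random pair tree, the pairs have
  the joint law of \<open>(Z t, Z' t)\<close>, so the average over \<open>\<sigma>\<close> becomes an expectation of a Rademacher
  process on the random tree of unprimed variables, which the cover bounds by Hoeffding's lemma.
  Centring the losses at \<open>M / 2\<close> gives the constant \<open>2\<close> under the root. The bound is not random,
  so it holds for all \<open>\<alpha>\<close> at once without a union bound.
\<close>

subsection \<open>Rademacher processes on a tree\<close>

text \<open>Times start at 1 and list positions at 0. The sign of time \<open>t\<close> is the first
  one that the node \<open>take (t - 1) \<sigma>\<close> does not yet fix.\<close>

definition sgn_at :: "bool list \<Rightarrow> nat \<Rightarrow> real" where
  "sgn_at \<sigma> t = (if \<sigma> ! (t - 1) then 1 else - 1)"

text \<open>Hoeffding's lemma for one fair sign. At \<open>2 * y\<close> and \<open>1 / 2\<close>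
  the function in \<open>Hoeffdings_lemma_aux\<close> is the logarithm of \<open>cosh y\<close>;
  evenness covers negative arguments.\<close>

lemma cosh_le_exp_half_square: "cosh x \<le> exp (x\<^sup>2 / 2)" for x :: real
proof -
  have *: "cosh y \<le> exp (y\<^sup>2 / 2)" if "0 \<le> y" for y :: real
  proof -
    have "- y + ln ((1 + exp (2 * y)) / 2) \<le> y\<^sup>2 / 2"
      using Hoeffdings_lemma_aux[of "2 * y" "1 / 2"] that
      by (simp add: field_simps power2_eq_square)
    then have "exp (- y + ln ((1 + exp (2 * y)) / 2)) \<le> exp (y\<^sup>2 / 2)" by simp
    also have "exp (- y + ln ((1 + exp (2 * y)) / 2)) = exp (- y) * ((1 + exp (2 * y)) / 2)"
      by (subst exp_add) (simp add: add_pos_pos)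
    also have "\<dots> = cosh y"
      by (simp add: cosh_def field_simps flip: exp_add)
    finally show ?thesis .
  qed
  show ?thesis
    using *[of "\<bar>x\<bar>"] by (cases "x \<ge> 0") (auto simp: abs_if)
qed

text \<open>The last sign is split off, not the first, because the node visited at time
  \<open>Suc n\<close> consists of all earlier signs.\<close>

lemma sum_bool_list_Suc:
  fixes g :: "bool list \<Rightarrow> 'a::comm_monoid_add"
  shows "(\<Sum>\<sigma> | length \<sigma> = Suc n. g \<sigma>) =
    (\<Sum>\<sigma> | length \<sigma> = n. g (\<sigma> @ [True]) + g (\<sigma> @ [False]))"
proof -
  have "(\<Sum>\<sigma> | length \<sigma> = Suc n. g \<sigma>) = (\<Sum>(\<sigma>, b)\<in>{\<sigma>. length \<sigma> = n} \<times> UNIV. g (\<sigma> @ [b]))"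
    by (rule sum.reindex_bij_witness[where i = "\<lambda>(\<sigma>, b). \<sigma> @ [b]" and j = "\<lambda>\<sigma>. (butlast \<sigma>, last \<sigma>)"])
      (auto simp: append_butlast_last_id length_Suc_conv_rev)
  also have "\<dots> = (\<Sum>\<sigma> | length \<sigma> = n. \<Sum>b\<in>UNIV. g (\<sigma> @ [b]))"
    by (simp add: sum.cartesian_product)
  finally show ?thesis by (simp add: UNIV_bool add.commute)
qed

text \<open>Azuma-Hoeffding on a tree: once the first \<open>n\<close> signs are fixed, the value at
  the next node is a constant, and summing over the last sign gives a \<open>cosh\<close>. Sums over
  sign sequences stand for expectations, hence the factor \<open>2 ^ n\<close>.\<close>

lemma rademacher_tree_mgf:
  fixes v :: "bool list \<Rightarrow> real"
  assumes "\<And>s. s \<in> nodes n \<Longrightarrow> \<bar>v s\<bar> \<le> B"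
  shows "(\<Sum>\<sigma> | length \<sigma> = n. exp (\<Sum>t=1..n. c t * sgn_at \<sigma> t * v (take (t - 1) \<sigma>)))
    \<le> 2 ^ n * exp ((\<Sum>t=1..n. (c t)\<^sup>2) * B\<^sup>2 / 2)"
  using assms
proof (induction n)
  case 0
  then show ?case by simp
next
  case (Suc n)
  let ?e = "\<lambda>\<sigma>. exp (\<Sum>t=1..n. c t * sgn_at \<sigma> t * v (take (t - 1) \<sigma>))"
  have ext: "exp (\<Sum>t=1..Suc n. c t * sgn_at (\<sigma> @ [b]) t * v (take (t - 1) (\<sigma> @ [b])))
      = ?e \<sigma> * exp ((if b then 1 else - 1) * (c (Suc n) * v \<sigma>))"
    if "length \<sigma> = n" for \<sigma> b
  proof -
    have "(\<Sum>t=1..n. c t * sgn_at (\<sigma> @ [b]) t * v (take (t - 1) (\<sigma> @ [b])))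
        = (\<Sum>t=1..n. c t * sgn_at \<sigma> t * v (take (t - 1) \<sigma>))"
      using that by (intro sum.cong) (auto simp: sgn_at_def nth_append)
    then show ?thesis
      using that by (auto simp: sgn_at_def exp_add)
  qed
  have "(\<Sum>\<sigma> | length \<sigma> = Suc n. exp (\<Sum>t=1..Suc n. c t * sgn_at \<sigma> t * v (take (t - 1) \<sigma>)))
      = (\<Sum>\<sigma> | length \<sigma> = n. ?e \<sigma> * (2 * cosh (c (Suc n) * v \<sigma>)))"
    unfolding sum_bool_list_Suc
    by (intro sum.cong refl) (simp only: mem_Collect_eq ext, simp add: cosh_def algebra_simps)
  also have "\<dots> \<le> (\<Sum>\<sigma> | length \<sigma> = n. ?e \<sigma> * (2 * exp ((c (Suc n))\<^sup>2 * B\<^sup>2 / 2)))"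
  proof (intro sum_mono mult_left_mono)
    fix \<sigma> :: "bool list" assume "\<sigma> \<in> {\<sigma>. length \<sigma> = n}"
    then have "\<bar>v \<sigma>\<bar> \<le> B" by (intro Suc.prems) (auto simp: nodes_def)
    then have "(v \<sigma>)\<^sup>2 \<le> B\<^sup>2" by (auto simp flip: abs_le_square_iff)
    then have "(c (Suc n) * v \<sigma>)\<^sup>2 \<le> (c (Suc n))\<^sup>2 * B\<^sup>2"
      by (simp add: power_mult_distrib mult_left_mono)
    then show "cosh (c (Suc n) * v \<sigma>) \<le> exp ((c (Suc n))\<^sup>2 * B\<^sup>2 / 2)"
      by (intro order.trans[OF cosh_le_exp_half_square]) simp
  qed auto
  also have "\<dots> = (\<Sum>\<sigma> | length \<sigma> = n. ?e \<sigma>) * (2 * exp ((c (Suc n))\<^sup>2 * B\<^sup>2 / 2))"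
    by (simp add: sum_distrib_right)
  also have "\<dots> \<le> (2 ^ n * exp ((\<Sum>t=1..n. (c t)\<^sup>2) * B\<^sup>2 / 2)) * (2 * exp ((c (Suc n))\<^sup>2 * B\<^sup>2 / 2))"
    using Suc.prems by (intro mult_right_mono Suc.IH) (auto simp: nodes_def)
  also have "\<dots> = 2 ^ Suc n * exp ((\<Sum>t=1..Suc n. (c t)\<^sup>2) * B\<^sup>2 / 2)"
    by (simp add: algebra_simps add_divide_distrib flip: exp_add)
  finally show ?case .
qed

section \<open>Finite sequential covers of a loss class\<close>

lemma sup_norm_pos:
  assumes "\<exists>t\<in>{1..n}. q t \<noteq> 0"
  shows "0 < sup_norm q n"
  using assms unfolding sup_norm_def by (subst Max_gr_iff) auto

lemma abs_le_sup_norm: "t \<in> {1..n} \<Longrightarrow> \<bar>q t\<bar> \<le> sup_norm q n"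
  unfolding sup_norm_def by (intro Max_ge) auto

text \<open>For each sign sequence the supremum exceeds the largest process of the cover by at most
  \<alpha>. The exponential of that maximum is at most the sum over \<open>V\<close>, and each
  summand is a Rademacher process with values bounded by \<open>M / 2\<close>, which turns the
  \<open>/ 2\<close> of \<open>rademacher_tree_mgf\<close> into \<open>/ 8\<close>.\<close>

lemma seq_cover_bound:
  fixes F :: "('z \<Rightarrow> real) set"
  assumes ne: "F \<noteq> {}" and q: "\<exists>t\<in>{1..n}. q t \<noteq> 0" and r: "0 \<le> r"
    and F: "\<And>f s. f \<in> F \<Longrightarrow> s \<in> nodes n \<Longrightarrow> 0 \<le> f (z s) \<and> f (z s) \<le> M"
    and V: "finite V" "seq_cover n q \<alpha> F z V"
  shows "(\<Sum>\<sigma> | length \<sigma> = n.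
      exp (r * (SUP f\<in>F. \<Sum>t=1..n. - q t * sgn_at \<sigma> t * (f (z (take (t - 1) \<sigma>)) - M / 2))))
    \<le> 2 ^ n * exp (r * \<alpha> + r\<^sup>2 * (\<Sum>t=1..n. (q t)\<^sup>2) * M\<^sup>2 / 8) * card V"
proof -
  \<comment> \<open>Covering trees may take any real value. Clipping to the interval from 0 to
    \<open>M\<close> never increases the distance to a loss value, and centring then bounds the
    result by \<open>M / 2\<close>.\<close>
  define cl where "cl x = max 0 (min M x) - M / 2" for x :: real
  let ?X = "\<lambda>v \<sigma>. \<Sum>t=1..n. - q t * sgn_at \<sigma> t * cl (v (take (t - 1) \<sigma>))"
  \<comment> \<open>A nonzero weight forces \<open>n\<close> to be positive, so the root is a node,
    and a loss there lies between 0 and \<open>M\<close>.\<close>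
  have "0 \<le> M"
  proof -
    obtain f where "f \<in> F" using ne by auto
    moreover have "[] \<in> nodes n" using q by (auto simp: nodes_def)
    ultimately show ?thesis using F[of f "[]"] by auto
  qed
  then have cl_bound: "\<bar>cl x\<bar> \<le> M / 2" for x by (auto simp: cl_def abs_if max_def min_def)
  have cl_dist: "\<bar>(y - M / 2) - cl x\<bar> \<le> \<bar>x - y\<bar>" if "0 \<le> y" "y \<le> M" for x y
    using that by (auto simp: cl_def max_def min_def)
  have "exp (r * (SUP f\<in>F. \<Sum>t=1..n. - q t * sgn_at \<sigma> t * (f (z (take (t - 1) \<sigma>)) - M / 2)))
      \<le> exp (r * \<alpha>) * (\<Sum>v\<in>V. exp (r * ?X v \<sigma>))" if \<sigma>: "length \<sigma> = n" for \<sigma>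
  proof -
    have near: "\<exists>v\<in>V. (\<Sum>t=1..n. - q t * sgn_at \<sigma> t * (f (z (take (t - 1) \<sigma>)) - M / 2)) \<le> \<alpha> + ?X v \<sigma>"
      if f: "f \<in> F" for f
    proof -
      obtain v where v: "v \<in> V" and
        le: "(\<Sum>t=1..n. \<bar>v (take (t - 1) \<sigma>) - f (z (take (t - 1) \<sigma>))\<bar>) \<le> inverse (sup_norm q n) * \<alpha>"
        using V(2) f \<sigma> unfolding seq_cover_def by blast
      have "(\<Sum>t=1..n. - q t * sgn_at \<sigma> t * (f (z (take (t - 1) \<sigma>)) - M / 2)) - ?X v \<sigma>
          = (\<Sum>t=1..n. - q t * sgn_at \<sigma> t * (f (z (take (t - 1) \<sigma>)) - M / 2 - cl (v (take (t - 1) \<sigma>))))"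
        by (simp add: right_diff_distrib flip: sum_subtractf)
      also have "\<dots> \<le> (\<Sum>t=1..n. sup_norm q n * \<bar>v (take (t - 1) \<sigma>) - f (z (take (t - 1) \<sigma>))\<bar>)"
      proof (rule sum_mono)
        fix t assume t: "t \<in> {1..n}"
        have "take (t - 1) \<sigma> \<in> nodes n" using t \<sigma> by (auto simp: nodes_def)
        note b = F[OF f this]
        have "- q t * sgn_at \<sigma> t * (f (z (take (t - 1) \<sigma>)) - M / 2 - cl (v (take (t - 1) \<sigma>)))
          \<le> \<bar>q t\<bar> * \<bar>f (z (take (t - 1) \<sigma>)) - M / 2 - cl (v (take (t - 1) \<sigma>))\<bar>"
          by (rule order.trans[OF abs_ge_self]) (simp add: abs_mult sgn_at_def)
        also have "\<dots> \<le> sup_norm q n * \<bar>v (take (t - 1) \<sigma>) - f (z (take (t - 1) \<sigma>))\<bar>"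
          using b by (intro mult_mono abs_le_sup_norm[OF t] cl_dist) (auto intro: order_trans[OF abs_ge_zero abs_le_sup_norm[OF t]])
        finally show "- q t * sgn_at \<sigma> t * (f (z (take (t - 1) \<sigma>)) - M / 2 - cl (v (take (t - 1) \<sigma>)))
          \<le> sup_norm q n * \<bar>v (take (t - 1) \<sigma>) - f (z (take (t - 1) \<sigma>))\<bar>" .
      qed
      \<comment> \<open>The inverse norm in the radius of the cover cancels against the bound on the
        weights.\<close>
      also have "\<dots> \<le> \<alpha>"
        using mult_left_mono[OF le, of "sup_norm q n"] sup_norm_pos[OF q]
        by (simp add: sum_distrib_left flip: mult.assoc)
      finally show ?thesis using v by (intro bexI[of _ v]) auto
    qed
    then have Vne: "V \<noteq> {}" using ne by auto
    \<comment> \<open>The tree near \<open>f\<close> varies with \<open>f\<close>. A maximiser over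
      the finite set \<open>V\<close> dominates all of them, so that the supremum over
      \<open>F\<close> can be taken.\<close>
    obtain v where v: "v \<in> V" and max: "\<And>v'. v' \<in> V \<Longrightarrow> ?X v' \<sigma> \<le> ?X v \<sigma>"
    proof -
      have "Max ((\<lambda>v. ?X v \<sigma>) ` V) \<in> (\<lambda>v. ?X v \<sigma>) ` V"
        using V(1) Vne by (intro Max_in) auto
      then obtain v where "v \<in> V" "Max ((\<lambda>v. ?X v \<sigma>) ` V) = ?X v \<sigma>" by auto
      then show ?thesis using V(1) that[of v] Max_ge[of "(\<lambda>v. ?X v \<sigma>) ` V"] by force
    qed
    have "(SUP f\<in>F. \<Sum>t=1..n. - q t * sgn_at \<sigma> t * (f (z (take (t - 1) \<sigma>)) - M / 2)) \<le> \<alpha> + ?X v \<sigma>"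
      using near max by (intro cSUP_least ne) force
    then have "exp (r * (SUP f\<in>F. \<Sum>t=1..n. - q t * sgn_at \<sigma> t * (f (z (take (t - 1) \<sigma>)) - M / 2)))
      \<le> exp (r * \<alpha>) * exp (r * ?X v \<sigma>)"
      using r by (simp add: mult_left_mono flip: exp_add distrib_left)
    \<comment> \<open>The maximiser depends on \<sigma>. Passing to the sum over all of
      \<open>V\<close> removes this dependence and lets the two sums be exchanged.\<close>
    also have "\<dots> \<le> exp (r * \<alpha>) * (\<Sum>v\<in>V. exp (r * ?X v \<sigma>))"
      using v V(1) by (intro mult_left_mono member_le_sum) auto
    finally show ?thesis .
  qed
  then have "(\<Sum>\<sigma> | length \<sigma> = n.
      exp (r * (SUP f\<in>F. \<Sum>t=1..n. - q t * sgn_at \<sigma> t * (f (z (take (t - 1) \<sigma>)) - M / 2))))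
    \<le> (\<Sum>\<sigma> | length \<sigma> = n. exp (r * \<alpha>) * (\<Sum>v\<in>V. exp (r * ?X v \<sigma>)))"
    by (intro sum_mono) auto
  also have "\<dots> = exp (r * \<alpha>) * (\<Sum>v\<in>V. \<Sum>\<sigma> | length \<sigma> = n. exp (r * ?X v \<sigma>))"
    by (subst sum.swap) (simp add: sum_distrib_left)
  also have "\<dots> \<le> exp (r * \<alpha>) * (\<Sum>v\<in>V. 2 ^ n * exp ((\<Sum>t=1..n. (r * - q t)\<^sup>2) * (M / 2)\<^sup>2 / 2))"
  proof (intro mult_left_mono sum_mono)
    fix v
    show "(\<Sum>\<sigma> | length \<sigma> = n. exp (r * ?X v \<sigma>)) \<le> 2 ^ n * exp ((\<Sum>t=1..n. (r * - q t)\<^sup>2) * (M / 2)\<^sup>2 / 2)"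
      using rademacher_tree_mgf[of n "\<lambda>s. cl (v s)" "M / 2" "\<lambda>t. r * - q t"] cl_bound
      by (simp add: sum_distrib_left mult.assoc)
  qed auto
  also have "\<dots> = 2 ^ n * exp (r * \<alpha> + r\<^sup>2 * (\<Sum>t=1..n. (q t)\<^sup>2) * M\<^sup>2 / 8) * card V"
    by (simp add: exp_add power_mult_distrib power_divide flip: sum_distrib_left)
  finally show ?thesis .
qed

subsection \<open>Branches of the pair tree\<close>

lemma nn_integral_PiM_insert:
  assumes "finite I" "i \<notin> I" and M: "\<And>j. j \<in> insert i I \<Longrightarrow> prob_space (M j)"
    and f: "f \<in> borel_measurable (PiM (insert i I) M)"
  shows "(\<integral>\<^sup>+ x. f x \<partial>PiM (insert i I) M) = (\<integral>\<^sup>+ x. \<integral>\<^sup>+ y. f (x(i := y)) \<partial>M i \<partial>PiM I M)"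
proof -
  \<comment> \<open>A point mass at the remaining indices makes every factor a probability measure,
    as the product locale demands, and leaves the products in question unchanged.\<close>
  define M' where "M' j = (if j \<in> insert i I then M j else return (count_space UNIV) undefined)" for j
  have eq: "PiM (insert i I) M' = PiM (insert i I) M" "PiM I M' = PiM I M" "M' i = M i"
    by (auto simp: M'_def intro!: PiM_cong)
  have "prob_space (M' j)" for j
    using M by (auto simp: M'_def intro: prob_space_return)
  then interpret product_sigma_finite M'
    by (intro product_sigma_finite.intro prob_space_imp_sigma_finite)
  show ?thesis
    using product_nn_integral_insert[of I i f] assms by (simp add: eq)
qed

lemma nn_integral_PiM_component:
  assumes "\<And>j. j \<in> I \<Longrightarrow> prob_space (M j)" "i \<in> I" "f \<in> borel_measurable (M i)"
  shows "(\<integral>\<^sup>+ x. f (x i) \<partial>PiM I M) = (\<integral>\<^sup>+ x. f x \<partial>M i)"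
  using assms nn_integral_distr[of "\<lambda>x. x i" "PiM I M" "M i" f]
  by (simp add: distr_PiM_component)

text \<open>The first component at each time is the draw that \<sigma> selects and on which later
  draws are conditioned; the second is its independent copy. The swap is what makes the joint law
  the same for every \<sigma>.\<close>

definition branch :: "bool list \<Rightarrow> (bool list \<Rightarrow> 'z \<times> 'z) \<Rightarrow> nat \<Rightarrow> 'z \<times> 'z" where
  "branch \<sigma> w = (\<lambda>t\<in>{1..length \<sigma>}.
     if \<sigma> ! (t - 1) then w (take (t - 1) \<sigma>) else prod.swap (w (take (t - 1) \<sigma>)))"

text \<open>The law at a node depends on the tree only through the branch leading there, so a branch
  can be followed without the rest of the tree.\<close>

lemma history_eq_branch: "history w \<sigma> = (\<lambda>i\<in>{1..length \<sigma>}. fst (branch \<sigma> w i))"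
  by (auto simp: history_def branch_def fun_eq_iff)

lemma measurable_branch:
  assumes "length \<sigma> = n"
  shows "branch \<sigma> \<in> PiM (nodes n) (\<lambda>_. S \<Otimes>\<^sub>M S) \<rightarrow>\<^sub>M PiM {1..n} (\<lambda>_. S \<Otimes>\<^sub>M S)"
  unfolding branch_def assms
proof (rule measurable_restrict)
  fix t assume t: "t \<in> {1..n}"
  have c: "(\<lambda>w. w (take (t - 1) \<sigma>)) \<in> PiM (nodes n) (\<lambda>_. S \<Otimes>\<^sub>M S) \<rightarrow>\<^sub>M S \<Otimes>\<^sub>M S"
    using t assms by (intro measurable_component_singleton) (auto simp: nodes_def)
  show "(\<lambda>w. if \<sigma> ! (t - 1) then w (take (t - 1) \<sigma>) else prod.swap (w (take (t - 1) \<sigma>)))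
      \<in> PiM (nodes n) (\<lambda>_. S \<Otimes>\<^sub>M S) \<rightarrow>\<^sub>M S \<Otimes>\<^sub>M S"
    using c measurable_compose[OF c measurable_pair_swap'] 
    by (cases "\<sigma> ! (t - 1)") (simp_all add: prod.swap_def split_beta')
qed

lemma branch_snoc_merge:
  assumes "length \<sigma> = n"
  shows "branch (\<sigma> @ [b]) (merge (nodes n) {s. length s = n} (w, u))
    = (branch \<sigma> w)(Suc n := (if b then u \<sigma> else prod.swap (u \<sigma>)))"
  using assms by (auto simp: branch_def fun_eq_iff merge_def nodes_def nth_append)

section \<open>Conditional laws as integration formulas\<close>

locale conditional_process = prob_space W for W :: "'w measure" +
  fixes S :: "'z measure" and Z :: "nat \<Rightarrow> 'w \<Rightarrow> 'z" and n :: nat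
    and p :: "nat \<Rightarrow> (nat \<Rightarrow> 'z) \<Rightarrow> 'z measure"
  assumes Z: "\<And>t. t \<in> {1..n} \<Longrightarrow> Z t \<in> W \<rightarrow>\<^sub>M S"
    and laws: "conditional_laws W S Z n p"
begin

lemma kernel: "t \<in> {1..n} \<Longrightarrow> p t \<in> PiM {1..<t} (\<lambda>_. S) \<rightarrow>\<^sub>M prob_algebra S"
  using laws by (auto simp: conditional_laws_def)

lemma measurable_past: "t \<le> Suc n \<Longrightarrow> past Z t \<in> W \<rightarrow>\<^sub>M PiM {1..<t} (\<lambda>_. S)"
  unfolding past_def by (intro measurable_restrict Z) auto

lemma kernel_past: "t \<in> {1..n} \<Longrightarrow> (\<lambda>\<omega>. p t (past Z t \<omega>)) \<in> W \<rightarrow>\<^sub>M prob_algebra S"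
  using measurable_compose[OF measurable_past kernel] by auto

lemma
  assumes "t \<in> {1..n}" "\<omega> \<in> space W"
  shows prob_space_kernel_past: "prob_space (p t (past Z t \<omega>))"
    and sets_kernel_past: "sets (p t (past Z t \<omega>)) = sets S"
  using measurable_space[OF kernel_past] assms by (auto simp: space_prob_algebra)

text \<open>Events of the past are preimages under \<open>past Z t\<close>. Integrating the
  conditional probability of \<open>Z t \<in> B\<close> over such an event is its defining property,
  with the kernel as the chosen version.\<close>

lemma nn_integral_conditional_law_rectangle:
  assumes t: "t \<in> {1..n}" and A: "A \<in> sets (PiM {1..<t} (\<lambda>_. S))" and B: "B \<in> sets S"
  shows "(\<integral>\<^sup>+ \<omega>. indicator A (past Z t \<omega>) * indicator B (Z t \<omega>) \<partial>W)
    = (\<integral>\<^sup>+ \<omega>. indicator A (past Z t \<omega>) * emeasure (p t (past Z t \<omega>)) B \<partial>W)"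
proof -
  let ?P = "PiM {1..<t} (\<lambda>_. S)"
  let ?F = "vimage_algebra (space W) (past Z t) ?P"
  let ?k = "\<lambda>\<omega>. p t (past Z t \<omega>)"
  note [measurable] = A B Z[OF t]
  have past [measurable]: "past Z t \<in> W \<rightarrow>\<^sub>M ?P" using t by (intro measurable_past) auto
  have sub: "subalgebra W ?F"
  proof -
    have "past Z t \<in> space W \<rightarrow> space ?P" using measurable_space[OF past] by blast
    then show ?thesis
      unfolding subalgebra_def sets_vimage_algebra2[OF \<open>past Z t \<in> space W \<rightarrow> space ?P\<close>]
      using measurable_sets[OF past] by auto
  qed
  interpret finite_measure_subalgebra W ?F
    by unfold_locales (rule sub)
  have [measurable]: "?k \<in> W \<rightarrow>\<^sub>M subprob_algebra S"
    using kernel_past[OF t] by (rule measurable_prob_algebraD)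
  note kp = prob_space_kernel_past[OF t]
  define A' where "A' = past Z t -` A \<inter> space W"
  have A': "A' \<in> sets ?F" unfolding A'_def by (intro in_vimage_algebra A)
  have AW [measurable]: "A' \<in> sets W" unfolding A'_def by measurable
  have i1: "integrable W (\<lambda>\<omega>. indicator B (Z t \<omega>) :: real)"
    by (intro integrable_const_bound[where B = 1] AE_I2) auto
  have m2: "(\<lambda>\<omega>. measure (?k \<omega>) B) \<in> borel_measurable W" by measurable
  have i2: "integrable W (\<lambda>\<omega>. measure (?k \<omega>) B)"
    using kp m2 by (intro integrable_const_bound[where B = 1] AE_I2) (auto simp: prob_space.prob_le_1)
  have "(\<integral>\<^sup>+ \<omega>. indicator A (past Z t \<omega>) * indicator B (Z t \<omega>) \<partial>W)
      = (\<integral>\<^sup>+ \<omega>. ennreal (indicator A' \<omega> * indicator B (Z t \<omega>)) \<partial>W)"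
    by (intro nn_integral_cong) (auto simp: A'_def split: split_indicator)
  also have "\<dots> = ennreal (\<integral>\<omega>\<in>A'. indicator B (Z t \<omega>) \<partial>W)"
    unfolding set_lebesgue_integral_def using integrable_mult_indicator[OF AW i1]
    by (subst nn_integral_eq_integral) auto
  also have "(\<integral>\<omega>\<in>A'. indicator B (Z t \<omega>) \<partial>W :: real) = (\<integral>\<omega>\<in>A'. measure (?k \<omega>) B \<partial>W)"
  proof (rule trans[OF real_cond_exp_intA[OF i1 A']])
    have "AE \<omega> in W. real_cond_exp W ?F (\<lambda>\<omega>. indicator B (Z t \<omega>)) \<omega> = measure (?k \<omega>) B"
      using laws t B by (auto simp: conditional_laws_def)
    then show "(\<integral>\<omega>\<in>A'. real_cond_exp W ?F (\<lambda>\<omega>. indicator B (Z t \<omega>)) \<omega> \<partial>W)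
            = (\<integral>\<omega>\<in>A'. measure (?k \<omega>) B \<partial>W)"
      unfolding set_lebesgue_integral_def
      using m2 by (intro integral_cong_AE) (auto elim!: eventually_mono)
  qed
  also have "ennreal \<dots> = (\<integral>\<^sup>+ \<omega>. ennreal (indicator A' \<omega> * measure (?k \<omega>) B) \<partial>W)"
    unfolding set_lebesgue_integral_def using integrable_mult_indicator[OF AW i2]
    by (subst nn_integral_eq_integral) auto
  also have "\<dots> = (\<integral>\<^sup>+ \<omega>. indicator A (past Z t \<omega>) * emeasure (?k \<omega>) B \<partial>W)"
    using kp by (intro nn_integral_cong)
      (auto simp: A'_def finite_measure.emeasure_eq_measure prob_space.finite_measure
        split: split_indicator)
  finally show ?thesis .
qed

text \<open>Disintegration of the joint law of past and present. Binding \<open>W\<close> to the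
  kernel \<open>?K\<close> produces a law that agrees with the joint law on rectangles; these are
  stable under intersection and generate the product.\<close>

lemma nn_integral_conditional_law:
  assumes t: "t \<in> {1..n}" and f: "f \<in> borel_measurable (PiM {1..<t} (\<lambda>_. S) \<Otimes>\<^sub>M S)"
  shows "(\<integral>\<^sup>+ \<omega>. f (past Z t \<omega>, Z t \<omega>) \<partial>W)
    = (\<integral>\<^sup>+ \<omega>. \<integral>\<^sup>+ x. f (past Z t \<omega>, x) \<partial>p t (past Z t \<omega>) \<partial>W)"
proof -
  let ?P = "PiM {1..<t} (\<lambda>_. S)"
  let ?k = "\<lambda>\<omega>. p t (past Z t \<omega>)"
  let ?K = "\<lambda>\<omega>. distr (?k \<omega>) (?P \<Otimes>\<^sub>M S) (\<lambda>x. (past Z t \<omega>, x))"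
  let ?J = "\<lambda>\<omega>. (past Z t \<omega>, Z t \<omega>)"
  note [measurable] = Z[OF t]
  have past [measurable]: "past Z t \<in> W \<rightarrow>\<^sub>M ?P" using t by (intro measurable_past) auto
  have k [measurable]: "?k \<in> W \<rightarrow>\<^sub>M subprob_algebra S"
    using kernel_past[OF t] by (rule measurable_prob_algebraD)
  note ks = sets_kernel_past[OF t]
  have kern: "?K \<in> W \<rightarrow>\<^sub>M subprob_algebra (?P \<Otimes>\<^sub>M S)"
    by (rule measurable_distr2[OF _ k]) measurable
  have pm: "(\<lambda>x. (past Z t \<omega>, x)) \<in> ?k \<omega> \<rightarrow>\<^sub>M ?P \<Otimes>\<^sub>M S" if "\<omega> \<in> space W" for \<omega>
    using measurable_space[OF past that] ks[OF that] by (simp cong: measurable_cong_sets)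
  have J: "?J \<in> W \<rightarrow>\<^sub>M ?P \<Otimes>\<^sub>M S" by measurable
  have law: "distr W (?P \<Otimes>\<^sub>M S) ?J = W \<bind> ?K"
  proof (rule measure_eqI_generator_eq[where E = "{A \<times> B | A B. A \<in> sets ?P \<and> B \<in> sets S}"
        and \<Omega> = "space ?P \<times> space S" and A = "\<lambda>_. space ?P \<times> space S"])
    show "Int_stable {A \<times> B | A B. A \<in> sets ?P \<and> B \<in> sets S}"
      by (rule Int_stable_pair_measure_generator)
    show "{A \<times> B | A B. A \<in> sets ?P \<and> B \<in> sets S} \<subseteq> Pow (space ?P \<times> space S)"
      by (rule pair_measure_closed)
    show "sets (distr W (?P \<Otimes>\<^sub>M S) ?J)
        = sigma_sets (space ?P \<times> space S) {A \<times> B | A B. A \<in> sets ?P \<and> B \<in> sets S}"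
      by (simp add: sets_pair_measure)
    show "sets (W \<bind> ?K)
        = sigma_sets (space ?P \<times> space S) {A \<times> B | A B. A \<in> sets ?P \<and> B \<in> sets S}"
      using not_empty by (subst sets_bind[where N = "?P \<Otimes>\<^sub>M S"]) (auto simp: sets_pair_measure)
    fix X assume "X \<in> {A \<times> B | A B. A \<in> sets ?P \<and> B \<in> sets S}"
    then obtain A B where X: "X = A \<times> B" and [measurable]: "A \<in> sets ?P" "B \<in> sets S" by auto
    have XS: "X \<in> sets (?P \<Otimes>\<^sub>M S)" unfolding X by measurable
    have "emeasure (distr W (?P \<Otimes>\<^sub>M S) ?J) X = (\<integral>\<^sup>+ \<omega>. indicator A (past Z t \<omega>) * indicator B (Z t \<omega>) \<partial>W)"
    proof -
      have "emeasure (distr W (?P \<Otimes>\<^sub>M S) ?J) X = (\<integral>\<^sup>+ y. indicator X y \<partial>distr W (?P \<Otimes>\<^sub>M S) ?J)"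
        unfolding X by (rule nn_integral_indicator[symmetric]) (simp only: sets_distr, measurable)
      also have "\<dots> = (\<integral>\<^sup>+ \<omega>. indicator X (?J \<omega>) \<partial>W)"
        unfolding X by (rule nn_integral_distr[OF J]) measurable
      also have "\<dots> = (\<integral>\<^sup>+ \<omega>. indicator A (past Z t \<omega>) * indicator B (Z t \<omega>) \<partial>W)"
        unfolding X by (intro nn_integral_cong) (simp add: indicator_times)
      finally show ?thesis .
    qed
    also have "\<dots> = (\<integral>\<^sup>+ \<omega>. indicator A (past Z t \<omega>) * emeasure (?k \<omega>) B \<partial>W)"
      by (rule nn_integral_conditional_law_rectangle) fact+
    also have "\<dots> = (\<integral>\<^sup>+ \<omega>. emeasure (?K \<omega>) X \<partial>W)"
    proof (rule nn_integral_cong)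
      fix \<omega> assume w: "\<omega> \<in> space W"
      have "(\<lambda>x. (past Z t \<omega>, x)) -` X \<inter> space (?k \<omega>) = (if past Z t \<omega> \<in> A then B else {})"
        using sets_eq_imp_space_eq[OF ks[OF w]] sets.sets_into_space[OF \<open>B \<in> sets S\<close>] by (auto simp: X)
      then show "indicator A (past Z t \<omega>) * emeasure (?k \<omega>) B = emeasure (?K \<omega>) X"
        using emeasure_distr[OF pm[OF w] XS] by simp
    qed
    also have "\<dots> = emeasure (W \<bind> ?K) X"
      by (rule emeasure_bind[symmetric, OF not_empty kern XS])
    finally show "emeasure (distr W (?P \<Otimes>\<^sub>M S) ?J) X = emeasure (W \<bind> ?K) X" .
  next
    show "range (\<lambda>_. space ?P \<times> space S) \<subseteq> {A \<times> B | A B. A \<in> sets ?P \<and> B \<in> sets S}" by auto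
    interpret D: prob_space "distr W (?P \<Otimes>\<^sub>M S) ?J" by (rule prob_space_distr[OF J])
    show "emeasure (distr W (?P \<Otimes>\<^sub>M S) ?J) (space ?P \<times> space S) \<noteq> \<infinity>"
      unfolding infinity_ennreal_def by (rule D.emeasure_finite)
  qed auto
  have "(\<integral>\<^sup>+ \<omega>. f (?J \<omega>) \<partial>W) = (\<integral>\<^sup>+ y. f y \<partial>(W \<bind> ?K))"
    unfolding law[symmetric] by (rule nn_integral_distr[symmetric, OF J]) (use f in simp)
  also have "\<dots> = (\<integral>\<^sup>+ \<omega>. \<integral>\<^sup>+ y. f y \<partial>?K \<omega> \<partial>W)"
    by (rule nn_integral_bind[OF f kern])
  also have "\<dots> = (\<integral>\<^sup>+ \<omega>. \<integral>\<^sup>+ x. f (past Z t \<omega>, x) \<partial>?k \<omega> \<partial>W)"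
    using pm f by (intro nn_integral_cong nn_integral_distr) auto
  finally show ?thesis .
qed

text \<open>The decoupled tangent sequence: given \<omega>, the copies are independent, and each
  follows the conditional law of \<open>Z t\<close> at the actual past, not at the past of the
  copies.\<close>

definition tangent :: "nat \<Rightarrow> 'w \<Rightarrow> (nat \<Rightarrow> 'z) measure" where
  "tangent m \<omega> = PiM {1..m} (\<lambda>t. p t (past Z t \<omega>))"

definition paired :: "nat \<Rightarrow> 'w \<Rightarrow> (nat \<Rightarrow> 'z) \<Rightarrow> nat \<Rightarrow> 'z \<times> 'z" where
  "paired m \<omega> z' = (\<lambda>t\<in>{1..m}. (Z t \<omega>, z' t))"

lemma tangent_kernel: "m \<le> n \<Longrightarrow> tangent m \<in> W \<rightarrow>\<^sub>M prob_algebra (PiM {1..m} (\<lambda>_. S))"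
  unfolding tangent_def by (intro measurable_PiM_kernel kernel_past) auto

lemma measurable_paired:
  "m \<le> n \<Longrightarrow> (\<lambda>(\<omega>, z'). paired m \<omega> z') \<in> W \<Otimes>\<^sub>M PiM {1..m} (\<lambda>_. S) \<rightarrow>\<^sub>M PiM {1..m} (\<lambda>_. S \<Otimes>\<^sub>M S)"
  unfolding paired_def case_prod_beta
  by (intro measurable_restrict measurable_Pair measurable_compose[OF measurable_fst Z]
      measurable_compose[OF measurable_snd measurable_component_singleton]) auto

text \<open>Induction along the branch. The next pair consists of two independent draws from one law
  determined by the first components, so a swap changes nothing; the first draw then continues the
  process and the second the tangent sequence.\<close>

lemma nn_integral_branch:
  assumes "length \<sigma> = m" "m \<le> n" "h \<in> borel_measurable (PiM {1..m} (\<lambda>_. S \<Otimes>\<^sub>M S))"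
  shows "(\<integral>\<^sup>+ w. h (branch \<sigma> w) \<partial>pair_tree_law p S m) = (\<integral>\<^sup>+ \<omega>. \<integral>\<^sup>+ z'. h (paired m \<omega> z') \<partial>tangent m \<omega> \<partial>W)"
  using assms
proof (induction m arbitrary: \<sigma> h)
  case 0
  have "prob_space (tangent 0 \<omega>)" for \<omega>
    unfolding tangent_def by (rule prob_space_PiM) auto
  then have "(\<integral>\<^sup>+ \<omega>. \<integral>\<^sup>+ z'. h (paired 0 \<omega> z') \<partial>tangent 0 \<omega> \<partial>W) = h (\<lambda>_. undefined)"
    by (simp add: paired_def restrict_def prob_space.emeasure_space_1 emeasure_space_1)
  moreover have "(\<lambda>w. h (branch \<sigma> w)) \<in> borel_measurable (PiM (nodes 0) (\<lambda>_. S \<Otimes>\<^sub>M S))"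
    by (rule measurable_compose[OF measurable_branch 0(3)]) (use 0 in simp)
  then have "(\<integral>\<^sup>+ w. h (branch \<sigma> w) \<partial>pair_tree_law p S 0) = h (branch \<sigma> (\<lambda>_. undefined))"
    unfolding pair_tree_law.simps
    by (subst nn_integral_return) (simp_all add: space_PiM nodes_def)
  moreover have "branch \<sigma> (\<lambda>_. undefined :: 'z \<times> 'z) = (\<lambda>_. undefined)"
    using 0 by (auto simp: branch_def)
  ultimately show ?case by simp
next
  case (Suc m)
  let ?N = "S \<Otimes>\<^sub>M S"
  let ?P = "\<lambda>J :: bool list set. PiM J (\<lambda>_. ?N)"
  let ?l = "{s :: bool list. length s = m}"
  let ?Q = "PiM {1..m} (\<lambda>_. ?N)"
  have tm: "Suc m \<in> {1..n}" using Suc.prems by auto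
  have ins: "{1..Suc m} = insert (Suc m) {1..m}" by auto
  have ivl: "{1..<Suc m} = {1..m}" by auto
  note h [measurable] = Suc.prems(3)
  obtain \<tau> b where \<sigma>: "\<sigma> = \<tau> @ [b]" and \<tau>: "length \<tau> = m"
    using Suc.prems(1) by (auto simp: length_Suc_conv_rev)
  have upd: "(\<lambda>(v, x). v(Suc m := x)) \<in> ?Q \<Otimes>\<^sub>M ?N \<rightarrow>\<^sub>M PiM {1..Suc m} (\<lambda>_. ?N)"
    unfolding ins by (rule measurable_add_dim)
  have hupd: "(\<lambda>(v, x). h (v(Suc m := x))) \<in> borel_measurable (?Q \<Otimes>\<^sub>M ?N)"
    using measurable_compose[OF upd h] by (simp only: split_beta')
  \<comment> \<open>The law at the end of a branch, as a function of the branch alone; see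
    \<open>history_eq_branch\<close>.\<close>
  define \<kappa> where "\<kappa> v = p (Suc m) (\<lambda>i\<in>{1..m}. fst (v i))" for v :: "nat \<Rightarrow> 'z \<times> 'z"
  have \<kappa>: "\<kappa> \<in> ?Q \<rightarrow>\<^sub>M prob_algebra S"
  proof -
    have "(\<lambda>v. \<lambda>i\<in>{1..m}. fst (v i)) \<in> ?Q \<rightarrow>\<^sub>M PiM {1..<Suc m} (\<lambda>_. S)"
      unfolding ivl
    proof (rule measurable_restrict)
      fix i assume "i \<in> {1..m}"
      note c = measurable_component_singleton[OF this, of "\<lambda>_. ?N"]
      show "(\<lambda>v. fst (v i)) \<in> ?Q \<rightarrow>\<^sub>M S"
        by (rule measurable_compose[OF c measurable_fst])
    qed
    from measurable_compose[OF this kernel[OF tm]] show ?thesis by (simp only: \<kappa>_def[abs_def])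
  qed
  then have \<kappa>' [measurable]: "\<kappa> \<in> ?Q \<rightarrow>\<^sub>M subprob_algebra S" by (rule measurable_prob_algebraD)
  \<comment> \<open>With the last pair integrated out, this is the test function for the induction
    hypothesis.\<close>
  define h' where "h' v = (\<integral>\<^sup>+ x. \<integral>\<^sup>+ y. h (v(Suc m := (x, y))) \<partial>\<kappa> v \<partial>\<kappa> v)" for v
  have hxy: "(\<lambda>((v, x), y). h (v(Suc m := (x, y)))) \<in> borel_measurable ((?Q \<Otimes>\<^sub>M S) \<Otimes>\<^sub>M S)"
  proof -
    have "(\<lambda>r. (fst (fst r), (snd (fst r), snd r))) \<in> (?Q \<Otimes>\<^sub>M S) \<Otimes>\<^sub>M S \<rightarrow>\<^sub>M ?Q \<Otimes>\<^sub>M ?N"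
      by measurable
    from measurable_compose[OF this hupd] show ?thesis by (simp only: split_beta' fst_conv snd_conv)
  qed
  have h': "h' \<in> borel_measurable ?Q"
  proof -
    have "(\<lambda>r. \<integral>\<^sup>+ y. h ((fst r)(Suc m := (snd r, y))) \<partial>\<kappa> (fst r)) \<in> borel_measurable (?Q \<Otimes>\<^sub>M S)"
    proof (rule nn_integral_measurable_subprob_algebra2)
      show "(\<lambda>(r, y). h ((fst r)(Suc m := (snd r, y)))) \<in> borel_measurable ((?Q \<Otimes>\<^sub>M S) \<Otimes>\<^sub>M S)"
        using hxy by (simp only: split_beta')
    qed measurable
    then have "(\<lambda>(v, x). \<integral>\<^sup>+ y. h (v(Suc m := (x, y))) \<partial>\<kappa> v) \<in> borel_measurable (?Q \<Otimes>\<^sub>M S)"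
      by (simp only: split_beta')
    then show ?thesis
      unfolding h'_def[abs_def] by (rule nn_integral_measurable_subprob_algebra2[OF _ \<kappa>'])
  qed
  have \<kappa>_prob: "prob_space (\<kappa> v)" and \<kappa>_sets: "sets (\<kappa> v) = sets S" if "v \<in> space ?Q" for v
    using measurable_space[OF \<kappa> that] by (auto simp: space_prob_algebra)
  have left: "(\<integral>\<^sup>+ w. h (branch \<sigma> w) \<partial>pair_tree_law p S (Suc m)) = (\<integral>\<^sup>+ w. h' (branch \<tau> w) \<partial>pair_tree_law p S m)"
  proof -
    have pt: "pair_tree_law p S m \<in> space (prob_algebra (?P (nodes m)))"
      using Suc.prems(2) by (intro pair_tree_law_in_prob_algebra kernel) auto
    then have pts: "sets (pair_tree_law p S m) = sets (?P (nodes m))"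
      by (auto simp: space_prob_algebra)
    define k where "k w s = p (Suc m) (history w s) \<Otimes>\<^sub>M p (Suc m) (history w s)"
      for w :: "bool list \<Rightarrow> 'z \<times> 'z" and s
    have k: "(\<lambda>w. k w s) \<in> ?P (nodes m) \<rightarrow>\<^sub>M prob_algebra ?N" if "s \<in> ?l" for s
    proof -
      have "(\<lambda>w. p (Suc m) (history w s)) \<in> ?P (nodes m) \<rightarrow>\<^sub>M prob_algebra S"
        using measurable_compose[OF measurable_history kernel[OF tm]] that by auto
      then show ?thesis unfolding k_def by (intro measurable_pair_prob)
    qed
    have kps: "prob_space (k w s)" "sets (k w s) = sets ?N" if "s \<in> ?l" "w \<in> space (?P (nodes m))" for w s
      using measurable_space[OF k[OF that(1)] that(2)] by (auto simp: space_prob_algebra)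
    have U: "nodes m \<union> ?l = nodes (Suc m)" by (auto simp: nodes_def)
    have mm: "merge (nodes m) ?l \<in> ?P (nodes m) \<Otimes>\<^sub>M ?P ?l \<rightarrow>\<^sub>M ?P (nodes (Suc m))"
      using measurable_merge[of "nodes m" ?l "\<lambda>_. ?N"] by (simp add: U)
    have kern: "(\<lambda>w. distr (PiM ?l (k w)) (?P (nodes (Suc m))) (\<lambda>u. merge (nodes m) ?l (w, u)))
        \<in> ?P (nodes m) \<rightarrow>\<^sub>M subprob_algebra (?P (nodes (Suc m)))"
      by (intro measurable_prob_algebraD
          measurable_distr_prob_space2[OF measurable_PiM_kernel[OF finite_level k]])
        (use mm in auto)
    have hp: "(\<lambda>w. h (branch \<sigma> w)) \<in> borel_measurable (?P (nodes (Suc m)))"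
      by (rule measurable_compose[OF measurable_branch h]) (use Suc.prems in simp)
    have "(\<integral>\<^sup>+ w. h (branch \<sigma> w) \<partial>pair_tree_law p S (Suc m))
        = (\<integral>\<^sup>+ w. \<integral>\<^sup>+ y. h (branch \<sigma> y) \<partial>distr (PiM ?l (k w)) (?P (nodes (Suc m)))
              (\<lambda>u. merge (nodes m) ?l (w, u)) \<partial>pair_tree_law p S m)"
      unfolding pair_tree_law.simps k_def[symmetric]
      by (rule nn_integral_bind[OF hp]) (use kern in \<open>simp cong: measurable_cong_sets add: pts\<close>)
    also have "\<dots> = (\<integral>\<^sup>+ w. h' (branch \<tau> w) \<partial>pair_tree_law p S m)"
    proof (rule nn_integral_cong)
      fix w assume "w \<in> space (pair_tree_law p S m)"
      then have w: "w \<in> space (?P (nodes m))" using sets_eq_imp_space_eq[OF pts] by simp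
      define v where "v = branch \<tau> w"
      have v: "v \<in> space ?Q"
        using measurable_space[OF measurable_branch w] \<tau> by (auto simp: v_def)
      interpret \<kappa>: prob_space "\<kappa> v" by (rule \<kappa>_prob[OF v])
      interpret \<kappa>\<kappa>: pair_sigma_finite "\<kappa> v" "\<kappa> v" ..
      note [measurable_cong] = \<kappa>_sets[OF v]
      have kv: "k w \<tau> = \<kappa> v \<Otimes>\<^sub>M \<kappa> v"
        using \<tau> by (simp add: k_def \<kappa>_def v_def history_eq_branch)
      have sets_K: "sets (PiM ?l (k w)) = sets (?P ?l)"
        using kps w by (intro sets_PiM_cong) auto
      have mw: "(\<lambda>u. merge (nodes m) ?l (w, u)) \<in> PiM ?l (k w) \<rightarrow>\<^sub>M ?P (nodes (Suc m))"
        using measurable_compose[OF measurable_Pair1'[OF w] mm] sets_K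
        by (simp cong: measurable_cong_sets)
      have hv [measurable]: "(\<lambda>x. h (v(Suc m := x))) \<in> borel_measurable ?N"
        using measurable_compose[OF measurable_Pair1'[OF v] hupd] by simp
      have "(\<integral>\<^sup>+ y. h (branch \<sigma> y) \<partial>distr (PiM ?l (k w)) (?P (nodes (Suc m))) (\<lambda>u. merge (nodes m) ?l (w, u)))
          = (\<integral>\<^sup>+ u. h (branch \<sigma> (merge (nodes m) ?l (w, u))) \<partial>PiM ?l (k w))"
        by (rule nn_integral_distr[OF mw]) (use hp in simp)
      also have "\<dots> = (\<integral>\<^sup>+ u. h (v(Suc m := (if b then u \<tau> else prod.swap (u \<tau>)))) \<partial>PiM ?l (k w))"
        by (simp add: \<sigma> branch_snoc_merge[OF \<tau>] v_def)
      \<comment> \<open>Of the pairs on the new level only the one at \<tau> lies on the branch; the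
        others integrate to 1.\<close>
      also have "\<dots> = (\<integral>\<^sup>+ x. h (v(Suc m := (if b then x else prod.swap x))) \<partial>k w \<tau>)"
      proof (rule nn_integral_PiM_component[where f = "\<lambda>x. h (v(Suc m := (if b then x else prod.swap x)))"])
        have "(\<lambda>x. if b then x else prod.swap x) \<in> ?N \<rightarrow>\<^sub>M ?N"
          by (cases b) (simp_all add: prod.swap_def)
        from measurable_compose[OF this hv]
        show "(\<lambda>x. h (v(Suc m := (if b then x else prod.swap x)))) \<in> borel_measurable (k w \<tau>)"
          using kps(2)[OF _ w] \<tau> by (simp cong: measurable_cong_sets)
      qed (use \<tau> kps w in auto)
      \<comment> \<open>For a negative sign the swap is absorbed by exchanging the order of
        integration, since both members of the pair have law \<open>\<kappa> v\<close>.\<close>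
      also have "\<dots> = h' v"
      proof -
        have "sets (\<kappa> v \<Otimes>\<^sub>M \<kappa> v) = sets ?N" by (intro sets_pair_measure_cong \<kappa>_sets v)
        from measurable_cong_sets[OF this refl]
        have hk: "(\<lambda>x. h (v(Suc m := x))) \<in> borel_measurable (\<kappa> v \<Otimes>\<^sub>M \<kappa> v)" using hv by blast
        have "prod.swap \<in> \<kappa> v \<Otimes>\<^sub>M \<kappa> v \<rightarrow>\<^sub>M \<kappa> v \<Otimes>\<^sub>M \<kappa> v"
          unfolding prod.swap_def by measurable
        note hs = measurable_compose[OF this hk]
        show ?thesis
          using \<kappa>.nn_integral_fst[OF hk] \<kappa>\<kappa>.nn_integral_snd[of "\<lambda>x. h (v(Suc m := prod.swap x))"] hs
          by (cases b) (simp_all add: kv h'_def split_beta')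
      qed
      finally show "(\<integral>\<^sup>+ y. h (branch \<sigma> y) \<partial>distr (PiM ?l (k w)) (?P (nodes (Suc m))) (\<lambda>u. merge (nodes m) ?l (w, u)))
          = h' (branch \<tau> w)" by (simp add: v_def)
    qed
    finally show ?thesis .
  qed
  \<comment> \<open>The disintegration formula needs a function of the past and the next value only.
    The law \<open>tangent m \<omega>\<close> qualifies because each of its factors sees a
    restriction of the past.\<close>
  define \<phi> where "\<phi> x\<^sub>0 x = (\<integral>\<^sup>+ z'. \<integral>\<^sup>+ y. h ((\<lambda>t\<in>{1..m}. (x\<^sub>0 t, z' t))(Suc m := (x, y)))
    \<partial>p (Suc m) x\<^sub>0 \<partial>PiM {1..m} (\<lambda>t. p t (restrict x\<^sub>0 {1..<t})))" for x\<^sub>0 x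
  have \<phi>_past: "\<phi> (past Z (Suc m) \<omega>) x = (\<integral>\<^sup>+ z'. \<integral>\<^sup>+ y. h ((paired m \<omega> z')(Suc m := (x, y)))
      \<partial>p (Suc m) (past Z (Suc m) \<omega>) \<partial>tangent m \<omega>)" for \<omega> x
  proof -
    have "PiM {1..m} (\<lambda>t. p t (restrict (past Z (Suc m) \<omega>) {1..<t})) = tangent m \<omega>"
      unfolding tangent_def
      by (intro PiM_cong arg_cong[where f = "p _"]) (auto simp: past_def fun_eq_iff)
    moreover have "(\<lambda>t\<in>{1..m}. (past Z (Suc m) \<omega> t, z' t)) = paired m \<omega> z'" for z'
      by (auto simp: paired_def past_def fun_eq_iff)
    ultimately show ?thesis by (simp add: \<phi>_def)
  qed
  have \<phi>: "(\<lambda>(x\<^sub>0, x). \<phi> x\<^sub>0 x) \<in> borel_measurable (PiM {1..<Suc m} (\<lambda>_. S) \<Otimes>\<^sub>M S)"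
  proof -
    let ?A = "PiM {1..<Suc m} (\<lambda>_. S)" and ?B = "PiM {1..m} (\<lambda>_. S)"
    have pk: "(\<lambda>x\<^sub>0. PiM {1..m} (\<lambda>t. p t (restrict x\<^sub>0 {1..<t}))) \<in> ?A \<rightarrow>\<^sub>M subprob_algebra ?B"
      using Suc.prems(2)
      by (intro measurable_prob_algebraD measurable_PiM_kernel measurable_compose[OF measurable_restrict_subset kernel]) auto
    have pS: "p (Suc m) \<in> ?A \<rightarrow>\<^sub>M subprob_algebra S"
      using kernel[OF tm] by (rule measurable_prob_algebraD)
    have base: "(\<lambda>(((x\<^sub>0, x), z'), y). h ((\<lambda>t\<in>{1..m}. (x\<^sub>0 t, z' t))(Suc m := (x, y))))
        \<in> borel_measurable (((?A \<Otimes>\<^sub>M S) \<Otimes>\<^sub>M ?B) \<Otimes>\<^sub>M S)"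
    proof -
      let ?R = "((?A \<Otimes>\<^sub>M S) \<Otimes>\<^sub>M ?B) \<Otimes>\<^sub>M S"
      have x\<^sub>0: "(\<lambda>r. fst (fst (fst r))) \<in> ?R \<rightarrow>\<^sub>M ?A" and z': "(\<lambda>r. snd (fst r)) \<in> ?R \<rightarrow>\<^sub>M ?B"
        and x: "(\<lambda>r. snd (fst (fst r))) \<in> ?R \<rightarrow>\<^sub>M S"
        by measurable
      have c: "(\<lambda>r. fst (fst (fst r)) t) \<in> ?R \<rightarrow>\<^sub>M S" if "t \<in> {1..m}" for t
        by (rule measurable_compose[OF x\<^sub>0 measurable_component_singleton]) (use that in auto)
      have d: "(\<lambda>r. snd (fst r) t) \<in> ?R \<rightarrow>\<^sub>M S" if "t \<in> {1..m}" for t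
        by (rule measurable_compose[OF z' measurable_component_singleton[OF that]])
      have "(\<lambda>r. ((\<lambda>t\<in>{1..m}. (fst (fst (fst r)) t, snd (fst r) t)), (snd (fst (fst r)), snd r)))
          \<in> ((?A \<Otimes>\<^sub>M S) \<Otimes>\<^sub>M ?B) \<Otimes>\<^sub>M S \<rightarrow>\<^sub>M ?Q \<Otimes>\<^sub>M ?N"
        by (intro measurable_Pair[OF measurable_restrict] measurable_Pair c d x measurable_snd)
      from measurable_compose[OF this hupd] show ?thesis by (simp only: split_beta' fst_conv snd_conv)
    qed
    have "(\<lambda>r. \<integral>\<^sup>+ y. h ((\<lambda>t\<in>{1..m}. (fst (fst r) t, snd r t))(Suc m := (snd (fst r), y))) \<partial>p (Suc m) (fst (fst r)))
        \<in> borel_measurable ((?A \<Otimes>\<^sub>M S) \<Otimes>\<^sub>M ?B)"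
    proof (rule nn_integral_measurable_subprob_algebra2)
      show "(\<lambda>(r, y). h ((\<lambda>t\<in>{1..m}. (fst (fst r) t, snd r t))(Suc m := (snd (fst r), y))))
          \<in> borel_measurable (((?A \<Otimes>\<^sub>M S) \<Otimes>\<^sub>M ?B) \<Otimes>\<^sub>M S)"
        using base by (simp only: split_beta')
      show "(\<lambda>r. p (Suc m) (fst (fst r))) \<in> (?A \<Otimes>\<^sub>M S) \<Otimes>\<^sub>M ?B \<rightarrow>\<^sub>M subprob_algebra S"
        by (rule measurable_compose[OF measurable_compose[OF measurable_fst measurable_fst] pS])
    qed
    then have "(\<lambda>(r, z'). \<integral>\<^sup>+ y. h ((\<lambda>t\<in>{1..m}. (fst r t, z' t))(Suc m := (snd r, y))) \<partial>p (Suc m) (fst r))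
        \<in> borel_measurable ((?A \<Otimes>\<^sub>M S) \<Otimes>\<^sub>M ?B)"
      by (simp only: split_beta')
    then have "(\<lambda>r. \<phi> (fst r) (snd r)) \<in> borel_measurable (?A \<Otimes>\<^sub>M S)"
      unfolding \<phi>_def
      by (rule nn_integral_measurable_subprob_algebra2[OF _ measurable_compose[OF measurable_fst pk]])
    then show ?thesis by (simp only: split_beta')
  qed
  have tprob: "prob_space (tangent m \<omega>)" and tsets: "sets (tangent m \<omega>) = sets (PiM {1..m} (\<lambda>_. S))"
    if "\<omega> \<in> space W" for \<omega>
    using measurable_space[OF tangent_kernel that, of m] Suc.prems(2) by (auto simp: space_prob_algebra)
  have pm: "paired k \<omega> \<in> PiM {1..k} (\<lambda>_. S) \<rightarrow>\<^sub>M PiM {1..k} (\<lambda>_. ?N)" if "\<omega> \<in> space W" "k \<le> n" for k \<omega>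
    using measurable_compose[OF measurable_Pair1'[OF that(1)] measurable_paired[OF that(2)]] by simp
  \<comment> \<open>Given \<omega>, the next value is drawn independently of the copies. Fubini
    moves its integral outermost, where the disintegration can replace it by
    \<open>Z (Suc m)\<close>.\<close>
  have mid: "(\<integral>\<^sup>+ z'. h' (paired m \<omega> z') \<partial>tangent m \<omega>)
      = (\<integral>\<^sup>+ x. \<phi> (past Z (Suc m) \<omega>) x \<partial>p (Suc m) (past Z (Suc m) \<omega>))" if w: "\<omega> \<in> space W" for \<omega>
  proof -
    define k where "k = p (Suc m) (past Z (Suc m) \<omega>)"
    interpret k: prob_space k unfolding k_def using prob_space_kernel_past[OF tm w] .
    interpret t: prob_space "tangent m \<omega>" using tprob[OF w] .
    interpret pair_sigma_finite k "tangent m \<omega>" ..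
    note [measurable_cong] = sets_kernel_past[OF tm w, folded k_def] tsets[OF w]
    \<comment> \<open>The first components of \<open>paired\<close> are the actual values, so the
      copies do not influence the next law.\<close>
    have k_eq: "\<kappa> (paired m \<omega> z') = k" for z'
      unfolding k_def \<kappa>_def
      by (rule arg_cong[where f = "p _"]) (auto simp: paired_def past_def fun_eq_iff)
    note [measurable] = pm[OF w, of m]
    have hxy': "(\<lambda>((x, z'), y). h ((paired m \<omega> z')(Suc m := (x, y)))) \<in> borel_measurable ((S \<Otimes>\<^sub>M PiM {1..m} (\<lambda>_. S)) \<Otimes>\<^sub>M S)"
    proof -
      have "(\<lambda>r. ((paired m \<omega> (snd (fst r)), fst (fst r)), snd r))
          \<in> (S \<Otimes>\<^sub>M PiM {1..m} (\<lambda>_. S)) \<Otimes>\<^sub>M S \<rightarrow>\<^sub>M (?Q \<Otimes>\<^sub>M S) \<Otimes>\<^sub>M S"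
        using Suc.prems(2)
        by (intro measurable_Pair measurable_compose[OF measurable_compose[OF measurable_fst measurable_snd] pm[OF w]]) auto
      from measurable_compose[OF this hxy] show ?thesis by (simp only: split_beta' fst_conv snd_conv)
    qed
    have hk: "(\<lambda>(x, z'). \<integral>\<^sup>+ y. h ((paired m \<omega> z')(Suc m := (x, y))) \<partial>k) \<in> borel_measurable (k \<Otimes>\<^sub>M tangent m \<omega>)"
    proof -
      have "(\<lambda>(r, y). h ((paired m \<omega> (snd r))(Suc m := (fst r, y)))) \<in> borel_measurable ((k \<Otimes>\<^sub>M tangent m \<omega>) \<Otimes>\<^sub>M k)"
      proof -
        have "sets ((k \<Otimes>\<^sub>M tangent m \<omega>) \<Otimes>\<^sub>M k) = sets ((S \<Otimes>\<^sub>M PiM {1..m} (\<lambda>_. S)) \<Otimes>\<^sub>M S)"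
          unfolding k_def by (intro sets_pair_measure_cong sets_kernel_past[OF tm w] tsets[OF w])
        note eq = measurable_cong_sets[OF this refl]
        show ?thesis unfolding eq using hxy' by (simp only: split_beta')
      qed
      from k.borel_measurable_nn_integral[OF this] show ?thesis by (simp only: split_beta')
    qed
    have "(\<integral>\<^sup>+ z'. h' (paired m \<omega> z') \<partial>tangent m \<omega>)
        = (\<integral>\<^sup>+ z'. \<integral>\<^sup>+ x. \<integral>\<^sup>+ y. h ((paired m \<omega> z')(Suc m := (x, y))) \<partial>k \<partial>k \<partial>tangent m \<omega>)"
      by (simp add: h'_def k_eq)
    also have "\<dots> = (\<integral>\<^sup>+ x. \<integral>\<^sup>+ z'. \<integral>\<^sup>+ y. h ((paired m \<omega> z')(Suc m := (x, y))) \<partial>k \<partial>tangent m \<omega> \<partial>k)"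
      by (rule Fubini'[OF hk])
    finally show ?thesis by (simp add: \<phi>_past k_def)
  qed
  have right: "(\<integral>\<^sup>+ z'. h (paired (Suc m) \<omega> z') \<partial>tangent (Suc m) \<omega>)
      = \<phi> (past Z (Suc m) \<omega>) (Z (Suc m) \<omega>)" if w: "\<omega> \<in> space W" for \<omega>
  proof -
    let ?M = "\<lambda>t. p t (past Z t \<omega>)"
    have "sets (PiM {1..Suc m} ?M) = sets (PiM {1..Suc m} (\<lambda>_. S))"
      using Suc.prems(2) by (intro sets_PiM_cong sets_kernel_past[OF _ w]) auto
    then have "(\<lambda>z'. h (paired (Suc m) \<omega> z')) \<in> borel_measurable (PiM (insert (Suc m) {1..m}) ?M)"
      using measurable_compose[OF pm[OF w] h] Suc.prems(2) unfolding ins[symmetric]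
      by (simp cong: measurable_cong_sets)
    then have "(\<integral>\<^sup>+ z'. h (paired (Suc m) \<omega> z') \<partial>tangent (Suc m) \<omega>)
        = (\<integral>\<^sup>+ z'. \<integral>\<^sup>+ y. h (paired (Suc m) \<omega> (z'(Suc m := y))) \<partial>?M (Suc m) \<partial>tangent m \<omega>)"
      unfolding tangent_def ins using Suc.prems(2)
      by (intro nn_integral_PiM_insert prob_space_kernel_past[OF _ w]) auto
    also have "\<dots> = (\<integral>\<^sup>+ z'. \<integral>\<^sup>+ y. h ((paired m \<omega> z')(Suc m := (Z (Suc m) \<omega>, y))) \<partial>?M (Suc m) \<partial>tangent m \<omega>)"
      by (intro nn_integral_cong arg_cong[where f = h]) (auto simp: paired_def fun_eq_iff)
    finally show ?thesis by (simp add: \<phi>_past)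
  qed
  have "(\<integral>\<^sup>+ w. h (branch \<sigma> w) \<partial>pair_tree_law p S (Suc m))
      = (\<integral>\<^sup>+ \<omega>. \<integral>\<^sup>+ z'. h' (paired m \<omega> z') \<partial>tangent m \<omega> \<partial>W)"
    unfolding left using Suc.prems(2) by (intro Suc.IH \<tau> h') auto
  also have "\<dots> = (\<integral>\<^sup>+ \<omega>. \<integral>\<^sup>+ x. \<phi> (past Z (Suc m) \<omega>) x \<partial>p (Suc m) (past Z (Suc m) \<omega>) \<partial>W)"
    by (rule nn_integral_cong) (rule mid)
  also have "\<dots> = (\<integral>\<^sup>+ \<omega>. \<phi> (past Z (Suc m) \<omega>) (Z (Suc m) \<omega>) \<partial>W)"
    using nn_integral_conditional_law[OF tm \<phi>] by simp
  finally show ?case by (simp add: right cong: nn_integral_cong)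
qed

end

subsection \<open>Symmetrization and concentration\<close>

lemma cSUP_diff_const:
  fixes g :: "'a \<Rightarrow> real"
  assumes "A \<noteq> {}" "bdd_above (g ` A)"
  shows "(SUP x\<in>A. g x - k) = (SUP x\<in>A. g x) - k"
proof (rule antisym)
  show "(SUP x\<in>A. g x - k) \<le> (SUP x\<in>A. g x) - k"
    using assms by (intro cSUP_least) (auto intro: cSUP_upper)
  have "bdd_above ((\<lambda>x. g x - k) ` A)"
    using assms(2) by (auto simp: bdd_above_def) (metis diff_right_mono)
  then have "g x \<le> (SUP x\<in>A. g x - k) + k" if "x \<in> A" for x
    using cSUP_upper[OF that, of "\<lambda>x. g x - k"] by simp
  then have "(SUP x\<in>A. g x) \<le> (SUP x\<in>A. g x - k) + k"
    using assms(1) by (intro cSUP_least) auto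
  then show "(SUP x\<in>A. g x) - k \<le> (SUP x\<in>A. g x - k)" by simp
qed

text \<open>The product of two numbers is at most the mean of their squares. This separates two
  summands of an exponent at the price of doubling \<open>r\<close>.\<close>

lemma exp_add_le_half:
  fixes x y :: real
  shows "exp (r * (x + y)) \<le> (exp (2 * r * x) + exp (2 * r * y)) / 2"
proof -
  have "exp (r * (x + y)) = exp (r * x) * exp (r * y)" by (simp add: distrib_left exp_add)
  also have "\<dots> \<le> ((exp (r * x))\<^sup>2 + (exp (r * y))\<^sup>2) / 2"
    using sum_squares_bound[of "exp (r * x)" "exp (r * y)"] by simp
  also have "\<dots> = (exp (2 * r * x) + exp (2 * r * y)) / 2"
    by (simp add: mult.assoc flip: exp_double)
  finally show ?thesis .
qed

text \<open>The integral on the right sees only the positive part of \<open>f\<close>. It is applied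
  to a tangent line, which takes negative values.\<close>

lemma integral_le_nn_integral:
  fixes f :: "'a \<Rightarrow> real"
  assumes "integrable M f"
  shows "ennreal (\<integral>x. f x \<partial>M) \<le> (\<integral>\<^sup>+ x. f x \<partial>M)"
proof -
  have "ennreal (\<integral>x. f x \<partial>M) \<le> ennreal (\<integral>x. max 0 (f x) \<partial>M)"
    using assms by (intro ennreal_leI integral_mono) auto
  also have "\<dots> = (\<integral>\<^sup>+ x. max 0 (f x) \<partial>M)"
    using assms by (intro nn_integral_eq_integral[symmetric]) auto
  also have "\<dots> = (\<integral>\<^sup>+ x. f x \<partial>M)"
    by (intro nn_integral_cong) (simp add: max_def ennreal_neg)
  finally show ?thesis .
qed

text \<open>Jensen's inequality, by integrating the tangent line of \<open>exp\<close> at the mean.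
  The right side is allowed to be infinite.\<close>

lemma (in prob_space) exp_expectation_le:
  assumes "integrable M X"
  shows "ennreal (exp (expectation X)) \<le> (\<integral>\<^sup>+ x. exp (X x) \<partial>M)"
proof -
  let ?m = "expectation X"
  have "ennreal (exp ?m) = ennreal (\<integral>x. exp ?m * (1 + (X x - ?m)) \<partial>M)"
    using assms by (simp add: prob_space)
  also have "\<dots> \<le> (\<integral>\<^sup>+ x. exp ?m * (1 + (X x - ?m)) \<partial>M)"
    using assms by (intro integral_le_nn_integral) simp
  also have "\<dots> \<le> (\<integral>\<^sup>+ x. exp (X x) \<partial>M)"
  proof (intro nn_integral_mono ennreal_leI)
    fix x
    have "exp ?m * (1 + (X x - ?m)) \<le> exp ?m * exp (X x - ?m)"
      by (intro mult_left_mono exp_ge_add_one_self) simp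
    then show "exp ?m * (1 + (X x - ?m)) \<le> exp (X x)" by (simp flip: exp_add)
  qed
  finally show ?thesis .
qed

lemma integral_PiM_component:
  fixes f :: "'a \<Rightarrow> real"
  assumes "\<And>j. j \<in> I \<Longrightarrow> prob_space (M j)" "i \<in> I" "f \<in> borel_measurable (M i)"
  shows "(\<integral>x. f (x i) \<partial>PiM I M) = (\<integral>x. f x \<partial>M i)"
  using assms integral_distr[of "\<lambda>x. x i" "PiM I M" "M i" f]
  by (simp add: distr_PiM_component)

text \<open>
  The thresholds may be uncountably many and the events for different thresholds unrelated; the
  limes superior of the events along thresholds tending to the infimum serves all of them.
\<close>

lemma (in prob_space) uniform_threshold:
  fixes C :: "real set"
  assumes "bdd_below C"
    and "\<And>c. c \<in> C \<Longrightarrow> \<exists>E\<in>events. 1 - \<delta> \<le> prob E \<and> (\<forall>\<omega>\<in>E. \<forall>i\<in>I. X i \<omega> \<le> c)"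
    and "0 \<le> \<delta>"
  shows "\<exists>E\<in>events. 1 - \<delta> \<le> prob E \<and> (\<forall>\<omega>\<in>E. \<forall>i\<in>I. \<forall>c\<in>C. X i \<omega> \<le> c)"
proof (cases "C = {}")
  case True
  then show ?thesis using assms(3) by (intro bexI[of _ "space M"]) (auto simp: prob_space)
next
  case False
  have "\<exists>c\<in>C. c < Inf C + inverse (real (Suc n))" for n
    using cInf_lessD[OF False, of "Inf C + inverse (real (Suc n))"] by simp
  then obtain c where c: "\<And>n. c n \<in> C" "\<And>n. c n < Inf C + inverse (real (Suc n))"
    by metis
  then have "\<exists>E. E \<in> events \<and> 1 - \<delta> \<le> prob E \<and> (\<forall>\<omega>\<in>E. \<forall>i\<in>I. X i \<omega> \<le> c n)" for n
    using assms(2)[of "c n"] by blast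
  then obtain E where E: "\<And>n. E n \<in> events" "\<And>n. 1 - \<delta> \<le> prob (E n)"
      "\<And>n \<omega> i. \<omega> \<in> E n \<Longrightarrow> i \<in> I \<Longrightarrow> X i \<omega> \<le> c n"
    by metis
  define D where "D k = (\<Union>n\<in>{k..}. E n)" for k
  have D: "D k \<in> events" for k unfolding D_def using E(1) by auto
  have "1 - \<delta> \<le> prob (D k)" for k
    using E(2)[of k] finite_measure_mono[of "E k" "D k"] D[of k] by (fastforce simp: D_def)
  moreover have "(\<lambda>k. prob (D k)) \<longlonglongrightarrow> prob (\<Inter>k. D k)"
  proof (rule finite_Lim_measure_decseq)
    show "decseq D" unfolding decseq_def D_def by (intro allI impI UN_mono) auto
  qed (use D in auto)
  ultimately have "1 - \<delta> \<le> prob (\<Inter>k. D k)"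
    by (intro LIMSEQ_le_const) auto
  moreover have "X i \<omega> \<le> a" if \<omega>: "\<omega> \<in> (\<Inter>k. D k)" and i: "i \<in> I" and a: "a \<in> C" for \<omega> i a
  proof -
    \<comment> \<open>A point of the limes superior lies in \<open>E n\<close> for arbitrarily large
      \<open>n\<close>, so it meets thresholds arbitrarily close to the infimum.\<close>
    have "X i \<omega> \<le> Inf C + inverse (real (Suc k))" for k
    proof -
      obtain n where n: "n \<ge> k" "\<omega> \<in> E n" using \<omega> by (auto simp: D_def)
      have "X i \<omega> \<le> c n" using E(3) n i by auto
      also have "\<dots> \<le> Inf C + inverse (real (Suc n))" using c(2) less_imp_le by blast
      also have "\<dots> \<le> Inf C + inverse (real (Suc k))" using n(1) by simp
      finally show ?thesis .
    qed
    then have "X i \<omega> \<le> Inf C + 0"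
      by (intro LIMSEQ_le_const[OF tendsto_add[OF tendsto_const LIMSEQ_inverse_real_of_nat]]) auto
    also have "\<dots> \<le> a" using cInf_lower[OF a assms(1)] by simp
    finally show ?thesis .
  qed
  ultimately show ?thesis
    using D by (intro bexI[of _ "\<Inter>k. D k"]) auto
qed

section \<open>The loss class, its centred supremum and symmetrization\<close>

locale bounded_loss_process = conditional_process W S Z "Suc T" p
  for W :: "'w measure" and S :: "'z measure" and Z :: "nat \<Rightarrow> 'w \<Rightarrow> 'z" and T :: nat
    and p :: "nat \<Rightarrow> (nat \<Rightarrow> 'z) \<Rightarrow> 'z measure" +
  fixes F :: "('z \<Rightarrow> real) set" and q :: "nat \<Rightarrow> real" and M :: real
  assumes F_nonempty: "F \<noteq> {}"
    and F_measurable: "measurable_class S F"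
    and F_bounds: "\<And>f z. f \<in> F \<Longrightarrow> z \<in> space S \<Longrightarrow> 0 \<le> f z \<and> f z \<le> M"
    and q_nonzero: "\<exists>t\<in>{1..T}. q t \<noteq> 0"
begin

lemma f_measurable: "f \<in> F \<Longrightarrow> f \<in> borel_measurable S"
  using F_measurable by (auto simp: measurable_class_def)

lemma M_nonneg: "0 \<le> M"
proof -
  obtain \<omega> where "\<omega> \<in> space W" using not_empty by auto
  then have "Z 1 \<omega> \<in> space S" using measurable_space[OF Z, of 1 \<omega>] by simp
  then show ?thesis using F_nonempty F_bounds by fastforce
qed

lemma
  assumes f: "f \<in> F" and t: "t \<in> {1..Suc T}" and \<omega>: "\<omega> \<in> space W"
  shows cond_mean_nonneg: "0 \<le> cond_mean p Z t f \<omega>"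
    and cond_mean_le: "cond_mean p Z t f \<omega> \<le> M"
proof -
  interpret K: prob_space "p t (past Z t \<omega>)" by (rule prob_space_kernel_past[OF t \<omega>])
  note s = sets_kernel_past[OF t \<omega>]
  note sp = sets_eq_imp_space_eq[OF s]
  show "0 \<le> cond_mean p Z t f \<omega>"
    unfolding cond_mean_def using F_bounds[OF f] sp by (intro integral_nonneg_AE AE_I2) auto
  have "integrable (p t (past Z t \<omega>)) f"
    using F_bounds[OF f] f_measurable[OF f] sp s
    by (intro K.integrable_const_bound[where B = M] AE_I2) (auto cong: measurable_cong_sets)
  then show "cond_mean p Z t f \<omega> \<le> M"
    unfolding cond_mean_def using F_bounds[OF f] sp by (intro K.integral_le_const AE_I2) auto
qed

text \<open>A real \<open>SUP\<close> has its meaning only on sets bounded above. The offset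
  \<open>k\<close> is 0 for the raw sums and \<open>M / 2\<close> for the centred ones.\<close>

lemma bdd_above_weighted_sums:
  assumes "\<And>t. t \<in> {1..m} \<Longrightarrow> z t \<in> space S"
  shows "bdd_above ((\<lambda>f. \<Sum>t=1..m. c t * (f (z t) - k)) ` F)"
proof (rule bdd_aboveI2)
  fix f assume f: "f \<in> F"
  show "(\<Sum>t=1..m. c t * (f (z t) - k)) \<le> (\<Sum>t=1..m. \<bar>c t\<bar> * (M + \<bar>k\<bar>))"
  proof (rule sum_mono)
    fix t assume "t \<in> {1..m}"
    then have "\<bar>f (z t) - k\<bar> \<le> M + \<bar>k\<bar>" using F_bounds[OF f assms] by fastforce
    then have "\<bar>c t * (f (z t) - k)\<bar> \<le> \<bar>c t\<bar> * (M + \<bar>k\<bar>)" by (simp add: abs_mult mult_left_mono)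
    then show "c t * (f (z t) - k) \<le> \<bar>c t\<bar> * (M + \<bar>k\<bar>)" by linarith
  qed
qed

text \<open>
  The losses are centred at \<open>M / 2\<close>, which does not affect differences of losses but halves
  their range.
\<close>

definition centred_sup :: "(nat \<Rightarrow> real) \<Rightarrow> (nat \<Rightarrow> 'z) \<Rightarrow> real" where
  "centred_sup c z = (SUP f\<in>F. \<Sum>t=1..T. c t * (f (z t) - M / 2))"

text \<open>Centring shifts the supremum by a constant, so measurability is inherited from the
  class. The shift is valid on the product space, where the suprema are finite.\<close>

lemma centred_sup_measurable: "centred_sup c \<in> borel_measurable (PiM {1..T} (\<lambda>_. S))"
proof -
  have eq: "centred_sup c z = (SUP f\<in>F. \<Sum>t=1..T. c t * f (z t)) - (\<Sum>t=1..T. c t * (M / 2))"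
    if "z \<in> space (PiM {1..T} (\<lambda>_. S))" for z
  proof -
    have "z t \<in> space S" if "t \<in> {1..T}" for t
      using \<open>z \<in> space (PiM {1..T} (\<lambda>_. S))\<close> that by (auto simp: space_PiM)
    then have "bdd_above ((\<lambda>f. \<Sum>t=1..T. c t * (f (z t) - 0)) ` F)"
      by (rule bdd_above_weighted_sums)
    then show ?thesis
      by (subst cSUP_diff_const[symmetric])
        (auto simp: centred_sup_def F_nonempty right_diff_distrib sum_subtractf)
  qed
  have "(\<lambda>z. (SUP f\<in>F. \<Sum>t=1..T. c t * f (z t)) - (\<Sum>t=1..T. c t * (M / 2)))
      \<in> borel_measurable (PiM {1..T} (\<lambda>_. S))"
    using F_measurable by (intro borel_measurable_diff) (auto simp: measurable_class_def)
  moreover note measurable_cong[of "PiM {1..T} (\<lambda>_. S)" "centred_sup c"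
      "\<lambda>z. (SUP f\<in>F. \<Sum>t=1..T. c t * f (z t)) - (\<Sum>t=1..T. c t * (M / 2))" borel, OF eq]
  ultimately show ?thesis by simp
qed

lemma centred_sup_upper:
  assumes "f \<in> F" "\<And>t. t \<in> {1..T} \<Longrightarrow> z t \<in> space S"
  shows "(\<Sum>t=1..T. c t * (f (z t) - M / 2)) \<le> centred_sup c z"
  unfolding centred_sup_def using assms by (intro cSUP_upper bdd_above_weighted_sums)

text \<open>Applied to a branch of \<sigma> this undoes the swap and returns the unprimed draws of
  the tree.\<close>

definition select :: "bool list \<Rightarrow> (nat \<Rightarrow> 'z \<times> 'z) \<Rightarrow> nat \<Rightarrow> 'z" where
  "select \<sigma> v = (\<lambda>t\<in>{1..T}. if \<sigma> ! (t - 1) then fst (v t) else snd (v t))"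

text \<open>The minus sign fits the gap: at a positive sign \<open>select\<close> takes the first
  member \<open>Z t\<close>, which enters with weight \<open>- q t\<close>; at a negative sign it
  takes the copy, with weight \<open>q t\<close>.\<close>

definition sign_moment :: "real \<Rightarrow> bool list \<Rightarrow> (nat \<Rightarrow> 'z \<times> 'z) \<Rightarrow> real" where
  "sign_moment r \<sigma> v = exp (r * centred_sup (\<lambda>t. - q t * sgn_at \<sigma> t) (select \<sigma> v))"

lemma sign_moment_measurable [measurable]:
  "sign_moment r \<sigma> \<in> borel_measurable (PiM {1..T} (\<lambda>_. S \<Otimes>\<^sub>M S))"
proof -
  have "select \<sigma> \<in> PiM {1..T} (\<lambda>_. S \<Otimes>\<^sub>M S) \<rightarrow>\<^sub>M PiM {1..T} (\<lambda>_. S)"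
    unfolding select_def
  proof (rule measurable_restrict)
    fix t assume "t \<in> {1..T}"
    note c = measurable_component_singleton[OF this, of "\<lambda>_. S \<Otimes>\<^sub>M S"]
    show "(\<lambda>v. if \<sigma> ! (t - 1) then fst (v t) else snd (v t)) \<in> PiM {1..T} (\<lambda>_. S \<Otimes>\<^sub>M S) \<rightarrow>\<^sub>M S"
      using measurable_compose[OF c measurable_fst] measurable_compose[OF c measurable_snd]
      by (cases "\<sigma> ! (t - 1)") simp_all
  qed
  from measurable_compose[OF this centred_sup_measurable] show ?thesis
    unfolding sign_moment_def by measurable
qed

lemma select_branch:
  "length \<sigma> = T \<Longrightarrow> select \<sigma> (branch \<sigma> w) = (\<lambda>t\<in>{1..T}. fst (w (take (t - 1) \<sigma>)))"
  by (auto simp: select_def branch_def fun_eq_iff)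

text \<open>A sign sequence and its negation select complementary members of every pair, so their
  two sums add up to the exponent and the centring cancels. Negation permutes the sign sequences,
  which merges the two halves after summation.\<close>

lemma symmetrization:
  assumes f: "f \<in> F" and v: "\<And>t. t \<in> {1..T} \<Longrightarrow> v t \<in> space (S \<Otimes>\<^sub>M S)" and r: "0 \<le> r"
  shows "2 ^ T * exp (r * (\<Sum>t=1..T. q t * (f (snd (v t)) - f (fst (v t)))))
    \<le> (\<Sum>\<sigma> | length \<sigma> = T. sign_moment (2 * r) \<sigma> v)"
proof -
  define x where "x \<sigma> = (\<Sum>t=1..T. - q t * sgn_at \<sigma> t * (f (select \<sigma> v t) - M / 2))" for \<sigma>
  have "exp (r * (\<Sum>t=1..T. q t * (f (snd (v t)) - f (fst (v t)))))
      \<le> (sign_moment (2 * r) \<sigma> v + sign_moment (2 * r) (map Not \<sigma>) v) / 2"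
    if \<sigma>: "length \<sigma> = T" for \<sigma>
  proof -
    have "x \<sigma> + x (map Not \<sigma>) = (\<Sum>t=1..T. q t * (f (snd (v t)) - f (fst (v t))))"
      unfolding x_def sum.distrib[symmetric] using \<sigma>
      by (intro sum.cong) (auto simp: select_def sgn_at_def algebra_simps)
    then have "exp (r * (\<Sum>t=1..T. q t * (f (snd (v t)) - f (fst (v t)))))
        \<le> (exp (2 * r * x \<sigma>) + exp (2 * r * x (map Not \<sigma>))) / 2"
      using exp_add_le_half by metis
    also have "exp (2 * r * x \<tau>) \<le> sign_moment (2 * r) \<tau> v" for \<tau>
    proof -
      have "select \<tau> v t \<in> space S" if "t \<in> {1..T}" for t
        using v[OF that] that by (auto simp: select_def space_pair_measure)
      then have "x \<tau> \<le> centred_sup (\<lambda>t. - q t * sgn_at \<tau> t) (select \<tau> v)"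
        unfolding x_def by (rule centred_sup_upper[OF f])
      then show ?thesis
        unfolding sign_moment_def using r by (simp add: mult_left_mono)
    qed
    then have "(exp (2 * r * x \<sigma>) + exp (2 * r * x (map Not \<sigma>))) / 2
        \<le> (sign_moment (2 * r) \<sigma> v + sign_moment (2 * r) (map Not \<sigma>) v) / 2"
      by (intro divide_right_mono add_mono) auto
    finally show ?thesis .
  qed
  then have "(\<Sum>\<sigma>\<in>{\<sigma> :: bool list. length \<sigma> = T}. exp (r * (\<Sum>t=1..T. q t * (f (snd (v t)) - f (fst (v t))))))
      \<le> (\<Sum>\<sigma> | length \<sigma> = T. (sign_moment (2 * r) \<sigma> v + sign_moment (2 * r) (map Not \<sigma>) v) / 2)"
    by (intro sum_mono) auto
  also have "\<dots> = ((\<Sum>\<sigma> | length \<sigma> = T. sign_moment (2 * r) \<sigma> v)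
      + (\<Sum>\<sigma> | length \<sigma> = T. sign_moment (2 * r) (map Not \<sigma>) v)) / 2"
    by (simp add: sum.distrib flip: sum_divide_distrib)
  also have "(\<Sum>\<sigma> | length \<sigma> = T. sign_moment (2 * r) (map Not \<sigma>) v)
      = (\<Sum>\<sigma> | length \<sigma> = T. sign_moment (2 * r) \<sigma> v)"
    by (rule sum.reindex_bij_witness[where i = "map Not" and j = "map Not"]) (auto simp: comp_def)
  finally show ?thesis
    using card_lists_length_eq[of "UNIV :: bool set" T] by simp
qed

text \<open>
  The supremum of \<open>exp (r * gap f \<omega>)\<close> over \<open>f\<close> involves conditional means and need not be measurable,
  so Markov's inequality is applied to this upper bound instead.
\<close>

definition majorant :: "real \<Rightarrow> 'w \<Rightarrow> ennreal" where
  "majorant r \<omega> = (\<integral>\<^sup>+ z'. (\<Sum>\<sigma> | length \<sigma> = T. sign_moment (2 * r) \<sigma> (paired T \<omega> z')) \<partial>tangent T \<omega>)"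

lemma majorant_measurable [measurable]: "majorant r \<in> borel_measurable W"
proof -
  have "(\<lambda>v. ennreal (\<Sum>\<sigma> | length \<sigma> = T. sign_moment (2 * r) \<sigma> v))
      \<in> borel_measurable (PiM {1..T} (\<lambda>_. S \<Otimes>\<^sub>M S))"
    by measurable
  from measurable_compose[OF measurable_paired this]
  have "(\<lambda>(\<omega>, z'). ennreal (\<Sum>\<sigma> | length \<sigma> = T. sign_moment (2 * r) \<sigma> (paired T \<omega> z')))
      \<in> borel_measurable (W \<Otimes>\<^sub>M PiM {1..T} (\<lambda>_. S))"
    by (simp add: split_beta')
  then show ?thesis
    unfolding majorant_def
    by (rule nn_integral_measurable_subprob_algebra2[OF _ measurable_prob_algebraD[OF tangent_kernel]]) simp
qed

text \<open>Up to sign, a weighted sum of martingale differences: the part of the prediction error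
  that the discrepancy does not account for.\<close>

definition gap :: "('z \<Rightarrow> real) \<Rightarrow> 'w \<Rightarrow> real" where
  "gap f \<omega> = (\<Sum>t=1..T. q t * (cond_mean p Z t f \<omega> - f (Z t \<omega>)))"

text \<open>The mean of the copy at time \<open>t\<close> is the conditional mean, so
  \<open>r * gap f \<omega>\<close> is an expectation under \<open>tangent T \<omega>\<close>.
  Jensen's inequality and \<open>symmetrization\<close> inside the integral remove the dependence on
  \<open>f\<close>.\<close>

lemma gap_le_majorant:
  assumes f: "f \<in> F" and \<omega>: "\<omega> \<in> space W" and r: "0 \<le> r"
  shows "ennreal (2 ^ T * exp (r * gap f \<omega>)) \<le> majorant r \<omega>"
proof -
  let ?M = "\<lambda>t. p t (past Z t \<omega>)"
  define X where "X z' = r * (\<Sum>t=1..T. q t * (f (z' t) - f (Z t \<omega>)))" for z'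
  have Mp: "prob_space (?M t)" and Ms: "sets (?M t) = sets S" if "t \<in> {1..T}" for t
    using prob_space_kernel_past[OF _ \<omega>] sets_kernel_past[OF _ \<omega>] that by auto
  interpret Q: prob_space "tangent T \<omega>"
    unfolding tangent_def by (intro prob_space_PiM Mp)
  have Qs: "sets (tangent T \<omega>) = sets (PiM {1..T} (\<lambda>_. S))"
    unfolding tangent_def by (intro sets_PiM_cong Ms) auto
  note Qsp = sets_eq_imp_space_eq[OF Qs]
  have int: "integrable (tangent T \<omega>) (\<lambda>z'. f (z' t))" if t: "t \<in> {1..T}" for t
  proof (rule Q.integrable_const_bound[where B = M])
    show "AE z' in tangent T \<omega>. norm (f (z' t)) \<le> M"
    proof (rule AE_I2)
      fix z' assume "z' \<in> space (tangent T \<omega>)"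
      then have "z' t \<in> space S" using t by (auto simp: Qsp space_PiM)
      then show "norm (f (z' t)) \<le> M" using F_bounds[OF f, of "z' t"] by simp
    qed
    show "(\<lambda>z'. f (z' t)) \<in> borel_measurable (tangent T \<omega>)"
      using measurable_compose[OF measurable_component_singleton[OF t] f_measurable[OF f]]
      by (simp cong: measurable_cong_sets add: Qs)
  qed
  have mean: "(\<integral>z'. f (z' t) \<partial>tangent T \<omega>) = cond_mean p Z t f \<omega>" if t: "t \<in> {1..T}" for t
  proof -
    have "f \<in> borel_measurable (?M t)"
      unfolding measurable_cong_sets[OF Ms[OF t] refl] by (rule f_measurable[OF f])
    then show ?thesis
      unfolding tangent_def cond_mean_def by (intro integral_PiM_component Mp t)
  qed
  have X: "integrable (tangent T \<omega>) X"
    unfolding X_def using int by (intro integrable_mult_right Bochner_Integration.integrable_sum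
        Bochner_Integration.integrable_diff) auto
  have "(\<integral>z'. X z' \<partial>tangent T \<omega>) = r * gap f \<omega>"
    unfolding X_def gap_def using int mean
    by (simp add: Bochner_Integration.integral_sum Q.prob_space)
  then have "ennreal (2 ^ T * exp (r * gap f \<omega>)) = ennreal (2 ^ T) * ennreal (exp (\<integral>z'. X z' \<partial>tangent T \<omega>))"
    by (simp add: ennreal_mult)
  also have "\<dots> \<le> ennreal (2 ^ T) * (\<integral>\<^sup>+ z'. exp (X z') \<partial>tangent T \<omega>)"
    by (intro mult_left_mono Q.exp_expectation_le X) simp
  also have "\<dots> = (\<integral>\<^sup>+ z'. ennreal (2 ^ T * exp (X z')) \<partial>tangent T \<omega>)"
    using X by (subst nn_integral_cmult[symmetric]) (auto simp: ennreal_mult)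
  also have "\<dots> \<le> majorant r \<omega>"
    unfolding majorant_def
  proof (intro nn_integral_mono ennreal_leI)
    fix z' assume "z' \<in> space (tangent T \<omega>)"
    then have "z' t \<in> space S" if "t \<in> {1..T}" for t using that by (auto simp: Qsp space_PiM)
    moreover have "Z t \<omega> \<in> space S" if "t \<in> {1..T}" for t
      using measurable_space[OF Z \<omega>] that by simp
    ultimately have "paired T \<omega> z' t \<in> space (S \<Otimes>\<^sub>M S)" if "t \<in> {1..T}" for t
      using that by (auto simp: paired_def space_pair_measure)
    from symmetrization[of f "paired T \<omega> z'" r, OF f this r]
    show "2 ^ T * exp (X z') \<le> (\<Sum>\<sigma> | length \<sigma> = T. sign_moment (2 * r) \<sigma> (paired T \<omega> z'))"
      by (simp add: X_def paired_def)
  qed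
  finally show ?thesis .
qed

section \<open>Expected moments and the expected cover number\<close>

definition moment_factor :: "real \<Rightarrow> real \<Rightarrow> real" where
  "moment_factor r \<alpha> = exp (2 * r * \<alpha> + r\<^sup>2 * (\<Sum>t=1..T. (q t)\<^sup>2) * M\<^sup>2 / 2)"

lemma moment_factor_pos [simp]: "0 < moment_factor r \<alpha>" "0 \<le> moment_factor r \<alpha>" "moment_factor r \<alpha> \<noteq> 0"
  by (simp_all add: moment_factor_def)

text \<open>By \<open>select_branch\<close> all summands refer to one and the same unprimed tree, so
  they form a Rademacher process on it and every finite cover of that tree gives a bound.\<close>

lemma sum_sign_moment_le:
  assumes w: "w \<in> space (PiM (nodes T) (\<lambda>_. S \<Otimes>\<^sub>M S))" and r: "0 \<le> r"
  shows "ennreal (\<Sum>\<sigma> | length \<sigma> = T. sign_moment (2 * r) \<sigma> (branch \<sigma> w))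
    \<le> ennreal (2 ^ T * moment_factor r \<alpha>) * seq_cover_num T q \<alpha> F (\<lambda>s\<in>nodes T. fst (w s))"
proof -
  let ?z = "\<lambda>s\<in>nodes T. fst (w s)" and ?C = "2 ^ T * moment_factor r \<alpha>"
  let ?s = "\<Sum>\<sigma> | length \<sigma> = T. sign_moment (2 * r) \<sigma> (branch \<sigma> w)"
  have C: "0 < ?C" by simp
  have s: "?s = (\<Sum>\<sigma> | length \<sigma> = T. exp (2 * r *
      (SUP f\<in>F. \<Sum>t=1..T. - q t * sgn_at \<sigma> t * (f (?z (take (t - 1) \<sigma>)) - M / 2))))"
    by (intro sum.cong refl)
      (auto simp: sign_moment_def select_branch centred_sup_def nodes_def
        intro!: arg_cong[where f = Sup] image_cong sum.cong)
  \<comment> \<open>Division by the constant leaves the bare cover number on the right, an infimum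
    that is \<infinity> if there is no finite cover.\<close>
  have "ennreal (?s / ?C) \<le> seq_cover_num T q \<alpha> F ?z"
    unfolding seq_cover_num_def
  proof (rule INF_greatest)
    fix V assume "V \<in> {V. finite V \<and> seq_cover T q \<alpha> F ?z V}"
    then have V: "finite V" "seq_cover T q \<alpha> F ?z V" by auto
    have "?z s \<in> space S" if "s \<in> nodes T" for s
      using w that by (auto simp: space_PiM space_pair_measure PiE_iff mem_Times_iff)
    then have "?s \<le> 2 ^ T * exp (2 * r * \<alpha> + (2 * r)\<^sup>2 * (\<Sum>t=1..T. (q t)\<^sup>2) * M\<^sup>2 / 8) * card V"
      unfolding s using F_bounds r
      by (intro seq_cover_bound[OF F_nonempty q_nonzero _ _ V]) auto
    \<comment> \<open>The cover bound is used at \<open>2 * r\<close>, which turns its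
      \<open>r\<^sup>2 / 8\<close> into the \<open>r\<^sup>2 / 2\<close> of
      \<open>moment_factor\<close>.\<close>
    then have "?s \<le> ?C * card V"
      by (simp add: moment_factor_def power_mult_distrib mult_ac)
    then have "?s / ?C \<le> card V" using C by (simp add: pos_divide_le_eq mult.commute)
    then have "ennreal (?s / ?C) \<le> ennreal (card V)" by (rule ennreal_leI)
    then show "ennreal (?s / ?C) \<le> of_nat (card V)" by (simp add: ennreal_of_nat_eq_real_of_nat)
  qed
  then have "ennreal ?C * ennreal (?s / ?C) \<le> ennreal ?C * seq_cover_num T q \<alpha> F ?z"
    by (intro mult_left_mono) auto
  moreover have "0 \<le> ?s" by (intro sum_nonneg) (simp add: sign_moment_def)
  ultimately show ?thesis
    using C by (simp flip: ennreal_mult)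
qed

definition expected_cover_num :: "real \<Rightarrow> ennreal" where
  "expected_cover_num \<alpha> = upper_expectation (tree_law p S T) (seq_cover_num T q \<alpha> F)"

text \<open>By \<open>nn_integral_branch\<close> each sign sequence contributes an integral over its
  own branch. All branches belong to one random tree, so the sum can be taken under a single
  integral and bounded tree by tree.\<close>

lemma expected_majorant_le:
  assumes r: "0 \<le> r"
  shows "(\<integral>\<^sup>+ \<omega>. majorant r \<omega> \<partial>W) \<le> ennreal (2 ^ T * moment_factor r \<alpha>) * expected_cover_num \<alpha>"
proof -
  let ?P = "pair_tree_law p S T" and ?N = "PiM (nodes T) (\<lambda>_. S \<Otimes>\<^sub>M S)"
  let ?C = "2 ^ T * moment_factor r \<alpha>" and ?I = "\<integral>\<^sup>+ \<omega>. majorant r \<omega> \<partial>W"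
  let ?fst = "\<lambda>w. \<lambda>s\<in>nodes T. fst (w s)"
  have Ps: "sets ?P = sets ?N"
    using pair_tree_law_in_prob_algebra[of T p S] kernel by (auto simp: space_prob_algebra)
  note Psp = sets_eq_imp_space_eq[OF Ps]
  have tangent_sets: "sets (tangent T \<omega>) = sets (PiM {1..T} (\<lambda>_. S))" if "\<omega> \<in> space W" for \<omega>
    using measurable_space[OF tangent_kernel that, of T] by (auto simp: space_prob_algebra)
  have pm: "(\<lambda>z'. sign_moment (2 * r) \<sigma> (paired T \<omega> z')) \<in> borel_measurable (tangent T \<omega>)"
    if "\<omega> \<in> space W" for \<omega> \<sigma>
    using measurable_compose[OF measurable_compose[OF measurable_Pair1'[OF that] measurable_paired[of T]]
        sign_moment_measurable] tangent_sets[OF that]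
    by (simp cong: measurable_cong_sets)
  have bm: "(\<lambda>w. ennreal (sign_moment (2 * r) \<sigma> (branch \<sigma> w))) \<in> borel_measurable ?P"
    if "length \<sigma> = T" for \<sigma>
    using measurable_compose[OF measurable_branch[OF that] sign_moment_measurable] Ps
    by (simp cong: measurable_cong_sets)
  have jm: "(\<lambda>\<omega>. \<integral>\<^sup>+ z'. ennreal (sign_moment (2 * r) \<sigma> (paired T \<omega> z')) \<partial>tangent T \<omega>) \<in> borel_measurable W" for \<sigma>
  proof -
    have "(\<lambda>v. ennreal (sign_moment (2 * r) \<sigma> v)) \<in> borel_measurable (PiM {1..T} (\<lambda>_. S \<Otimes>\<^sub>M S))"
      by measurable
    from measurable_compose[OF measurable_paired this]
    have "(\<lambda>(\<omega>, z'). ennreal (sign_moment (2 * r) \<sigma> (paired T \<omega> z')))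
        \<in> borel_measurable (W \<Otimes>\<^sub>M PiM {1..T} (\<lambda>_. S))"
      by (simp add: split_beta')
    then show ?thesis
      by (rule nn_integral_measurable_subprob_algebra2[OF _ measurable_prob_algebraD[OF tangent_kernel]]) simp
  qed
  have fst_m: "?fst \<in> ?P \<rightarrow>\<^sub>M PiM (nodes T) (\<lambda>_. S)"
    unfolding measurable_cong_sets[OF Ps refl] by (intro measurable_restrict) simp
  have "?I = (\<integral>\<^sup>+ \<omega>. (\<Sum>\<sigma> | length \<sigma> = T. \<integral>\<^sup>+ z'. sign_moment (2 * r) \<sigma> (paired T \<omega> z') \<partial>tangent T \<omega>) \<partial>W)"
    unfolding majorant_def
    by (intro nn_integral_cong)
      (subst sum_ennreal[symmetric], simp add: sign_moment_def, intro nn_integral_sum, use pm in simp)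
  also have "\<dots> = (\<Sum>\<sigma> | length \<sigma> = T. \<integral>\<^sup>+ \<omega>. \<integral>\<^sup>+ z'. sign_moment (2 * r) \<sigma> (paired T \<omega> z') \<partial>tangent T \<omega> \<partial>W)"
    by (intro nn_integral_sum jm)
  also have "\<dots> = (\<Sum>\<sigma> | length \<sigma> = T. \<integral>\<^sup>+ w. sign_moment (2 * r) \<sigma> (branch \<sigma> w) \<partial>?P)"
  proof (rule sum.cong[OF refl])
    fix \<sigma> :: "bool list" assume "\<sigma> \<in> {\<sigma>. length \<sigma> = T}"
    then have "length \<sigma> = T" by simp
    moreover have "(\<lambda>v. ennreal (sign_moment (2 * r) \<sigma> v)) \<in> borel_measurable (PiM {1..T} (\<lambda>_. S \<Otimes>\<^sub>M S))"
      by measurable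
    ultimately show "(\<integral>\<^sup>+ \<omega>. \<integral>\<^sup>+ z'. sign_moment (2 * r) \<sigma> (paired T \<omega> z') \<partial>tangent T \<omega> \<partial>W)
        = (\<integral>\<^sup>+ w. sign_moment (2 * r) \<sigma> (branch \<sigma> w) \<partial>?P)"
      by (intro nn_integral_branch[symmetric]) simp_all
  qed
  also have "\<dots> = (\<integral>\<^sup>+ w. (\<Sum>\<sigma> | length \<sigma> = T. ennreal (sign_moment (2 * r) \<sigma> (branch \<sigma> w))) \<partial>?P)"
    by (intro nn_integral_sum[symmetric] bm) auto
  \<comment> \<open>The chain continues for an arbitrary dominating \<open>g\<close>, because the
    upper expectation is an infimum over such functions.\<close>
  also have "\<dots> \<le> (\<integral>\<^sup>+ w. ennreal ?C * g (?fst w) \<partial>?P)"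
    if g: "\<And>x. x \<in> space (PiM (nodes T) (\<lambda>_. S)) \<Longrightarrow> seq_cover_num T q \<alpha> F x \<le> g x" for g
  proof (rule nn_integral_mono)
    fix w assume w: "w \<in> space ?P"
    have "(\<Sum>\<sigma> | length \<sigma> = T. ennreal (sign_moment (2 * r) \<sigma> (branch \<sigma> w)))
        \<le> ennreal ?C * seq_cover_num T q \<alpha> F (?fst w)"
      using sum_sign_moment_le[of w r \<alpha>] w r
      by (subst sum_ennreal) (auto simp: Psp sign_moment_def)
    also have "\<dots> \<le> ennreal ?C * g (?fst w)"
      using measurable_space[OF fst_m w] by (intro mult_left_mono g) auto
    finally show "(\<Sum>\<sigma> | length \<sigma> = T. ennreal (sign_moment (2 * r) \<sigma> (branch \<sigma> w))) \<le> ennreal ?C * g (?fst w)" .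
  qed
  finally have *: "?I \<le> (\<integral>\<^sup>+ w. ennreal ?C * g (?fst w) \<partial>?P)"
    if "\<And>x. x \<in> space (PiM (nodes T) (\<lambda>_. S)) \<Longrightarrow> seq_cover_num T q \<alpha> F x \<le> g x" for g
    using that by blast
  have C: "0 < ?C" by simp
  then have inv: "ennreal (1 / ?C) * ennreal ?C = 1"
    by (subst ennreal_mult[symmetric]) auto
  \<comment> \<open>The constant goes to the left so that the infimum can be bounded from below one
    \<open>g\<close> at a time.\<close>
  have "ennreal (1 / ?C) * ?I \<le> expected_cover_num \<alpha>"
    unfolding expected_cover_num_def upper_expectation_def
  proof (rule INF_greatest)
    fix g assume "g \<in> {g \<in> borel_measurable (tree_law p S T). \<forall>x\<in>space (tree_law p S T). seq_cover_num T q \<alpha> F x \<le> g x}"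
    then have g: "g \<in> borel_measurable (PiM (nodes T) (\<lambda>_. S))"
      and dom: "\<And>x. x \<in> space (PiM (nodes T) (\<lambda>_. S)) \<Longrightarrow> seq_cover_num T q \<alpha> F x \<le> g x"
      by (auto simp: tree_law_def)
    have "?I \<le> (\<integral>\<^sup>+ w. ennreal ?C * g (?fst w) \<partial>?P)" by (rule *[OF dom])
    also have "\<dots> = ennreal ?C * (\<integral>\<^sup>+ x. g x \<partial>tree_law p S T)"
      unfolding tree_law_def using measurable_compose[OF fst_m g] g
      by (simp add: nn_integral_distr[OF fst_m] nn_integral_cmult)
    finally have "ennreal (1 / ?C) * ?I \<le> ennreal (1 / ?C) * (ennreal ?C * (\<integral>\<^sup>+ x. g x \<partial>tree_law p S T))"
      by (intro mult_left_mono) auto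
    also have "\<dots> = (\<integral>\<^sup>+ x. g x \<partial>tree_law p S T)"
      by (simp only: mult.assoc[symmetric] inv mult_1_left)
    finally show "ennreal (1 / ?C) * ?I \<le> (\<integral>\<^sup>+ x. g x \<partial>tree_law p S T)" .
  qed
  then have "ennreal ?C * (ennreal (1 / ?C) * ?I) \<le> ennreal ?C * expected_cover_num \<alpha>"
    by (intro mult_left_mono) auto
  then show ?thesis
    by (simp only: mult.assoc[symmetric] mult.commute[of "ennreal ?C"] inv mult_1_left)
qed

section \<open>Tail bound for the gap\<close>

lemma expected_cover_num_ge_1: "1 \<le> expected_cover_num \<alpha>"
proof -
  have N: "1 \<le> seq_cover_num T q \<alpha> F z" for z
    unfolding seq_cover_num_def
  proof (rule INF_greatest)
    fix V assume "V \<in> {V. finite V \<and> seq_cover T q \<alpha> F z V}"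
    then have V: "finite V" "seq_cover T q \<alpha> F z V" by auto
    \<comment> \<open>A loss and one sign sequence suffice to demand a member of the cover.\<close>
    have "length (replicate T True) = T" by simp
    then have "V \<noteq> {}" using V(2) F_nonempty unfolding seq_cover_def by blast
    then have "1 \<le> card V" using V(1) by (simp add: Suc_le_eq card_gt_0_iff)
    then have "of_nat 1 \<le> (of_nat (card V) :: ennreal)" by (rule of_nat_mono)
    then show "1 \<le> (of_nat (card V) :: ennreal)" by simp
  qed
  interpret tree: prob_space "tree_law p S T"
    using tree_law_in_prob_algebra[of T p S] kernel by (auto simp: space_prob_algebra)
  show ?thesis
    unfolding expected_cover_num_def upper_expectation_def
  proof (rule INF_greatest)
    fix g assume g: "g \<in> {g \<in> borel_measurable (tree_law p S T). \<forall>x\<in>space (tree_law p S T). seq_cover_num T q \<alpha> F x \<le> g x}"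
    have "1 = (\<integral>\<^sup>+ x. 1 \<partial>tree_law p S T)" by (simp add: tree.emeasure_space_1)
    also have "\<dots> \<le> (\<integral>\<^sup>+ x. g x \<partial>tree_law p S T)"
      using g N by (intro nn_integral_mono) (auto intro: order.trans)
    finally show "1 \<le> (\<integral>\<^sup>+ x. g x \<partial>tree_law p S T)" .
  qed
qed

text \<open>As \<open>enn2real\<close> sends \<infinity> to 0, this is the intended deviation term
  only where the expected cover number is finite.\<close>

definition deviation :: "real \<Rightarrow> real \<Rightarrow> real" where
  "deviation \<delta> \<alpha> = M * L2_set q {1..T} * sqrt (2 * ln (enn2real (expected_cover_num \<alpha>) / \<delta>))"

text \<open>The expected cover number is at least 1 and \<delta> is below 1, so the logarithm is
  positive and the root is a genuine one.\<close>

lemma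
  assumes fin: "expected_cover_num \<alpha> \<noteq> \<infinity>" and \<delta>: "0 < \<delta>" "\<delta> < 1"
  shows cover_ratio_gt_1: "1 < enn2real (expected_cover_num \<alpha>) / \<delta>"
    and deviation_nonneg: "0 \<le> deviation \<delta> \<alpha>"
proof -
  have "1 \<le> enn2real (expected_cover_num \<alpha>)"
    using enn2real_mono[OF expected_cover_num_ge_1[of \<alpha>]] fin by (simp add: top.not_eq_extremum)
  then show *: "1 < enn2real (expected_cover_num \<alpha>) / \<delta>"
    using \<delta> by (simp add: less_divide_eq)
  show "0 \<le> deviation \<delta> \<alpha>"
    unfolding deviation_def using * M_nonneg by (intro mult_nonneg_nonneg L2_set_nonneg) auto
qed

text \<open>Chernoff's method: Markov's inequality for \<open>majorant r\<close> at the optimal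
  \<open>r\<close>. The deviation is the number for which the resulting bound equals
  \<delta>.\<close>

lemma gap_tail:
  assumes fin: "expected_cover_num \<alpha> \<noteq> \<infinity>" and \<delta>: "0 < \<delta>" "\<delta> < 1" and M: "0 < M"
  shows "\<exists>E\<in>events. 1 - \<delta> \<le> prob E \<and> (\<forall>\<omega>\<in>E. \<forall>f\<in>F. gap f \<omega> \<le> 2 * \<alpha> + deviation \<delta> \<alpha>)"
proof -
  define \<nu> where "\<nu> = enn2real (expected_cover_num \<alpha>)"
  have N: "expected_cover_num \<alpha> = ennreal \<nu>" using fin by (simp add: \<nu>_def less_top)
  have \<nu>: "1 < \<nu> / \<delta>" using cover_ratio_gt_1[OF fin \<delta>] by (simp add: \<nu>_def)
  then have \<nu>0: "0 < \<nu>" using \<delta> by (simp add: less_divide_eq)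
  define Q where "Q = (\<Sum>t=1..T. (q t)\<^sup>2)"
  define \<epsilon> where "\<epsilon> = deviation \<delta> \<alpha>"
  have Q: "0 < Q" unfolding Q_def using q_nonzero by (auto intro: sum_pos2)
  have \<epsilon>_sq: "\<epsilon>\<^sup>2 = 2 * M\<^sup>2 * Q * ln (\<nu> / \<delta>)"
    using \<nu> Q by (simp add: \<epsilon>_def deviation_def L2_set_def power_mult_distrib \<nu>_def Q_def sum_nonneg)
  have \<epsilon>: "0 < \<epsilon>"
  proof -
    have "0 < \<epsilon>\<^sup>2" unfolding \<epsilon>_sq using M Q \<nu> by simp
    then show ?thesis using deviation_nonneg[OF fin \<delta>] by (simp add: \<epsilon>_def)
  qed
  \<comment> \<open>The minimiser of \<open>r\<^sup>2 * Q * M\<^sup>2 / 2 - r * \<epsilon>\<close>,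
    where this expression equals \<open>- ln (\<nu> / \<delta>)\<close>.\<close>
  define r where "r = \<epsilon> / (M\<^sup>2 * Q)"
  have r: "0 < r" using \<epsilon> M Q by (simp add: r_def)
  \<comment> \<open>The reciprocal of \<open>2 ^ T * exp (r * gap f \<omega>)\<close> at the
    threshold \<open>2 * \<alpha> + \<epsilon>\<close>.\<close>
  define c where "c = inverse (2 ^ T * exp (r * (2 * \<alpha> + \<epsilon>)))"
  have c: "0 < c" by (simp add: c_def)
  have exponent: "r\<^sup>2 * Q * M\<^sup>2 / 2 - r * \<epsilon> = - ln (\<nu> / \<delta>)"
  proof -
    have "r\<^sup>2 * Q * M\<^sup>2 / 2 - r * \<epsilon> = - (\<epsilon>\<^sup>2 / (2 * M\<^sup>2 * Q))"
      using M Q by (simp add: r_def field_simps power2_eq_square)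
    then show ?thesis using M Q by (simp add: \<epsilon>_sq)
  qed
  have "c * (2 ^ T * moment_factor r \<alpha>) * \<nu> = exp (r\<^sup>2 * Q * M\<^sup>2 / 2 - r * \<epsilon>) * \<nu>"
    by (simp add: c_def moment_factor_def Q_def field_simps flip: exp_add exp_minus)
  also have "\<dots> = \<delta>"
    unfolding exponent using \<nu> \<nu>0 \<delta> by (simp add: exp_minus)
  finally have level: "c * (2 ^ T * moment_factor r \<alpha>) * \<nu> = \<delta>" .
  \<comment> \<open>The bad event is stated through the majorant, which makes it measurable and the
    same for all \<open>f\<close>.\<close>
  define B where "B = {\<omega> \<in> space W. 1 \<le> ennreal c * majorant r \<omega>}"
  have B: "B \<in> events" unfolding B_def by measurable
  have "emeasure W B \<le> ennreal c * (\<integral>\<^sup>+ \<omega>. majorant r \<omega> * indicator (space W) \<omega> \<partial>W)"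
    unfolding B_def by (intro nn_integral_Markov_inequality) measurable
  also have "\<dots> = ennreal c * (\<integral>\<^sup>+ \<omega>. majorant r \<omega> \<partial>W)"
    by (intro arg_cong[where f = "(*) _"] nn_integral_cong) simp
  also have "\<dots> \<le> ennreal c * (ennreal (2 ^ T * moment_factor r \<alpha>) * ennreal \<nu>)"
    unfolding N[symmetric] using r by (intro mult_left_mono expected_majorant_le) auto
  also have "\<dots> = ennreal \<delta>"
    using c \<nu>0 level by (simp add: moment_factor_def mult.assoc flip: ennreal_mult)
  finally have "prob B \<le> \<delta>" using \<delta> by (simp add: emeasure_eq_measure)
  then have "1 - \<delta> \<le> prob (space W - B)" using prob_compl[OF B] by simp
  moreover have "gap f \<omega> \<le> 2 * \<alpha> + \<epsilon>" if \<omega>: "\<omega> \<in> space W - B" and f: "f \<in> F" for \<omega> f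
  proof -
    have "ennreal (exp (r * gap f \<omega> - r * (2 * \<alpha> + \<epsilon>))) = ennreal c * ennreal (2 ^ T * exp (r * gap f \<omega>))"
      using c by (simp add: c_def exp_diff field_simps flip: ennreal_mult)
    also have "\<dots> \<le> ennreal c * majorant r \<omega>"
      using \<omega> f r by (intro mult_left_mono gap_le_majorant) auto
    also have "\<dots> < 1" using \<omega> by (auto simp: B_def)
    finally have "exp (r * gap f \<omega> - r * (2 * \<alpha> + \<epsilon>)) < 1" by simp
    then show ?thesis using r by (simp flip: right_diff_distrib add: mult_less_0_iff)
  qed
  ultimately show ?thesis using B by (intro bexI[of _ "space W - B"]) (auto simp: \<epsilon>_def)
qed

lemma gap_bound:
  assumes "0 < \<delta>" "\<delta> < 1"
  shows "\<exists>E\<in>events. 1 - \<delta> \<le> prob E \<and> (\<forall>\<omega>\<in>E. \<forall>f\<in>F. \<forall>\<alpha>>0.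
    expected_cover_num \<alpha> \<noteq> \<infinity> \<longrightarrow> gap f \<omega> \<le> 2 * \<alpha> + deviation \<delta> \<alpha>)"
\<comment> \<open>The optimal \<open>r\<close> divides by \<open>M\<^sup>2\<close>. For
  \<open>M = 0\<close> all losses vanish, hence also the gaps.\<close>
proof (cases "M = 0")
  case True
  have "gap f \<omega> = 0" if "f \<in> F" "\<omega> \<in> space W" for f \<omega>
  proof -
    have "cond_mean p Z t f \<omega> = 0" "f (Z t \<omega>) = 0" if "t \<in> {1..T}" for t
      using cond_mean_nonneg[of f t \<omega>] cond_mean_le[of f t \<omega>] F_bounds[of f "Z t \<omega>"]
        measurable_space[OF Z, of t \<omega>] \<open>f \<in> F\<close> \<open>\<omega> \<in> space W\<close> that True by auto
    then show ?thesis by (simp add: gap_def)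
  qed
  moreover have "deviation \<delta> \<alpha> = 0" for \<alpha>
    unfolding deviation_def by (simp only: True mult_zero_left)
  ultimately show ?thesis
    using assms by (intro bexI[of _ "space W"]) (auto simp: prob_space)
next
  case False
  then have M: "0 < M" using M_nonneg by simp
  \<comment> \<open>Only those \<alpha> with a finite expected cover number contribute a threshold.
    All thresholds are nonnegative, so \<open>uniform_threshold\<close> applies.\<close>
  define C where "C = (\<lambda>\<alpha>. 2 * \<alpha> + deviation \<delta> \<alpha>) ` {\<alpha>. 0 < \<alpha> \<and> expected_cover_num \<alpha> \<noteq> \<infinity>}"
  have "\<exists>E\<in>events. 1 - \<delta> \<le> prob E \<and> (\<forall>\<omega>\<in>E. \<forall>f\<in>F. \<forall>c\<in>C. gap f \<omega> \<le> c)"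
  proof (rule uniform_threshold)
    show "bdd_below C"
      unfolding C_def using deviation_nonneg[OF _ assms] by (intro bdd_belowI2[of _ 0]) fastforce
    show "\<exists>E\<in>events. 1 - \<delta> \<le> prob E \<and> (\<forall>\<omega>\<in>E. \<forall>f\<in>F. gap f \<omega> \<le> c)" if "c \<in> C" for c
      using that gap_tail[OF _ assms M] by (auto simp: C_def)
  qed (use assms in simp)
  then show ?thesis unfolding C_def by blast
qed

section \<open>From the gap to the prediction bound\<close>

lemma cond_mean_le_gap_plus_disc:
  assumes f: "f \<in> F" and \<omega>: "\<omega> \<in> space W"
  shows "cond_mean p Z (Suc T) f \<omega> \<le> (\<Sum>t=1..T. q t * f (Z t \<omega>)) + disc p Z T F q \<omega> + gap f \<omega>"
proof -
  \<comment> \<open>The supremum in \<open>disc\<close> is a real one, so it dominates its members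
    only once it is known to be bounded: all conditional means lie between 0 and
    \<open>M\<close>.\<close>
  have "bdd_above ((\<lambda>f. cond_mean p Z (Suc T) f \<omega> - (\<Sum>t=1..T. q t * cond_mean p Z t f \<omega>)) ` F)"
  proof (rule bdd_aboveI2)
    fix g assume g: "g \<in> F"
    have "- (q t * cond_mean p Z t g \<omega>) \<le> \<bar>q t\<bar> * M" if "t \<in> {1..T}" for t
    proof -
      have "\<bar>q t * cond_mean p Z t g \<omega>\<bar> \<le> \<bar>q t\<bar> * M"
        using cond_mean_nonneg[OF g _ \<omega>, of t] cond_mean_le[OF g _ \<omega>, of t] that
        by (simp add: abs_mult mult_left_mono)
      then show ?thesis by linarith
    qed
    then have "- (\<Sum>t=1..T. q t * cond_mean p Z t g \<omega>) \<le> (\<Sum>t=1..T. \<bar>q t\<bar> * M)"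
      unfolding sum_negf[symmetric] by (intro sum_mono)
    then show "cond_mean p Z (Suc T) g \<omega> - (\<Sum>t=1..T. q t * cond_mean p Z t g \<omega>) \<le> M + (\<Sum>t=1..T. \<bar>q t\<bar> * M)"
      using cond_mean_le[OF g _ \<omega>, of "Suc T"] by simp
  qed
  then have "cond_mean p Z (Suc T) f \<omega> - (\<Sum>t=1..T. q t * cond_mean p Z t f \<omega>) \<le> disc p Z T F q \<omega>"
    unfolding disc_def by (intro cSUP_upper f)
  then show ?thesis by (simp add: gap_def right_diff_distrib sum_subtractf)
qed

end

text \<open>The good outcomes are only required to contain a measurable event of sufficient
  probability. One such event serves all \<open>f\<close> and \<alpha>; an infinite expected cover
  number makes the bound infinite, since \<open>enn2real\<close> would return 0 there.\<close>

theorem corollary2: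
  fixes W :: "'w measure" and X :: "'x measure" and Y :: "'y measure"
    and L :: "'y \<Rightarrow> 'y \<Rightarrow> real" and H :: "('x \<Rightarrow> 'y) set" and F :: "('x \<times> 'y \<Rightarrow> real) set"
    and Z :: "nat \<Rightarrow> 'w \<Rightarrow> 'x \<times> 'y"
    and p :: "nat \<Rightarrow> (nat \<Rightarrow> 'x \<times> 'y) \<Rightarrow> ('x \<times> 'y) measure"
    and q :: "nat \<Rightarrow> real" and T :: nat and M \<delta> :: real
  assumes "prob_space W"
    and "\<And>h. h \<in> H \<Longrightarrow> h \<in> space X \<rightarrow> space Y"
    and "\<And>y y'. y \<in> space Y \<Longrightarrow> y' \<in> space Y \<Longrightarrow> 0 \<le> L y y'"
    and "F = loss_class L H"
    and "\<And>f z. f \<in> F \<Longrightarrow> z \<in> space (X \<Otimes>\<^sub>M Y) \<Longrightarrow> \<bar>f z\<bar> \<le> M"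
    and "measurable_class (X \<Otimes>\<^sub>M Y) F"
    and "\<And>t. t \<in> {1..Suc T} \<Longrightarrow> Z t \<in> W \<rightarrow>\<^sub>M X \<Otimes>\<^sub>M Y"
    and "conditional_laws W (X \<Otimes>\<^sub>M Y) Z (Suc T) p"
    and "\<exists>t\<in>{1..T}. q t \<noteq> 0"
    and "0 < \<delta>"
  shows "\<exists>E\<in>sets W. 1 - \<delta> \<le> measure W E \<and>
    (\<forall>\<omega>\<in>E. \<forall>f\<in>F. \<forall>\<alpha>>0.
       let N = upper_expectation (tree_law p (X \<Otimes>\<^sub>M Y) T) (seq_cover_num T q \<alpha> F)
       in ereal (cond_mean p Z (Suc T) f \<omega>)
          \<le> (if N = \<infinity> then \<infinity>
             else ereal ((\<Sum>t=1..T. q t * f (Z t \<omega>)) + disc p Z T F q \<omega> + 2 * \<alpha>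
                    + M * L2_set q {1..T} * sqrt (2 * ln (enn2real N / \<delta>)))))"
\<comment> \<open>An empty class makes the claim vacuous on the whole space, and for
  \<open>1 \<le> \<delta>\<close> the empty event will do. The locale and \<open>gap_bound\<close>
  need the remaining case.\<close>
proof (cases "F = {} \<or> 1 \<le> \<delta>")
  case True
  then show ?thesis
  proof
    assume "F = {}"
    then show ?thesis
      using assms(1,10) by (intro bexI[of _ "space W"]) (auto simp: prob_space.prob_space)
  qed (intro bexI[of _ "{}"], auto)
next
  case False
  have "0 \<le> f z" if "f \<in> F" "z \<in> space (X \<Otimes>\<^sub>M Y)" for f z
    using that assms(2,3) by (fastforce simp: assms(4) loss_class_def space_pair_measure)
  then interpret bounded_loss_process W "X \<Otimes>\<^sub>M Y" Z T p F q M
    using False assms(1,5-9)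
    by (intro bounded_loss_process.intro conditional_process.intro conditional_process_axioms.intro
        bounded_loss_process_axioms.intro) (auto simp: abs_le_iff)
  obtain E where E: "E \<in> events" "1 - \<delta> \<le> prob E"
    and gap: "\<And>\<omega> f \<alpha>. \<omega> \<in> E \<Longrightarrow> f \<in> F \<Longrightarrow> 0 < \<alpha> \<Longrightarrow> expected_cover_num \<alpha> \<noteq> \<infinity> \<Longrightarrow>
      gap f \<omega> \<le> 2 * \<alpha> + deviation \<delta> \<alpha>"
    using gap_bound[of \<delta>] assms(10) False by (auto simp: not_le)
  have "ereal (cond_mean p Z (Suc T) f \<omega>) \<le> (if expected_cover_num \<alpha> = \<infinity> then \<infinity>
      else ereal ((\<Sum>t=1..T. q t * f (Z t \<omega>)) + disc p Z T F q \<omega> + 2 * \<alpha> + deviation \<delta> \<alpha>))"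
    if "\<omega> \<in> E" "f \<in> F" "0 < \<alpha>" for \<omega> f \<alpha>
    using gap[OF that] cond_mean_le_gap_plus_disc[of f \<omega>] that sets.sets_into_space[OF E(1)] by fastforce
  then show ?thesis
    using E unfolding Let_def expected_cover_num_def[symmetric] deviation_def[symmetric] by blast
qed

end
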